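(* Let $1\le p\le n$, $\varepsilon\in(0,1)$, let $f:\mathbb{R}^{n\times p}\to\mathbb{R}$, and let $X_\star\in\mathrm{St}(p,n)$ be a local minimizer of $f$ over $\mathrm{St}(p,n)$. Assume: (A1) $f$ is twice continuously differentiable and $L_0$-Lipschitz in $\mathrm{St}(p,n)^\varepsilon$; the Euclidean gradient $\nabla f$ is $L_1$-Lipschitz continuous in $\mathrm{St}(p,n)^\varepsilon$; and there exist $L_2>0$ and $\delta_0>0$ such that $\|\nabla^2 f(X)-\nabla^2 f(Y)\|\le L_2\|X-Y\|_{\mathrm F}$ for all $X,Y\in B_{\delta_0}(X_\star)$. (A2) $X_\star$ is a nondegenerate local minimizer, i.e. the Riemannian Hessian $\mathrm{Hess} f(X_\star)$ is positive definite on the tangent space $\mathrm{T}_{X_\star}\mathrm{St}(p,n)$. Let $\zeta_{\max}\in(0,1)$ and $\theta>0$. Let $(X_k)$ be generated by the unit-step inexact iteration $$X_{k+1}=X_k+\Lambda(X_k),\qquad \Lambda(X_k)=\widetilde T(X_k)+N(X_k),$$ where $N(X)=-\tfrac12 X(X^\top X-I_p)$ and $\widetilde T(X_k)\in \mathrm{T}_{X_k}\mathrm{St}_{X_k^\top X_k}(p,n)$ satisfies $$\|r(X_k)\|_{\mathrm F}\le\min\{\zeta_{\max},\|b(X_k)\|_{\mathrm F}^{\theta}\}\,\|b(X_k)\|_{\mathrm F},$$ with $b(X)=-\mathrm{grad} f(X)-\mathcal{A}_{\mathrm N}(X)[N(X)]$ and $r(X)=\mathcal{A}_{\mathrm T}(X)[\widetilde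 T(X)]-b(X)$. Then there exists $\tilde\delta>0$ such that, for all $X_0\in B_{\tilde\delta}(X_\star)\cap\mathrm{St}(p,n)^\varepsilon$, the iterates remain in $\mathrm{St}(p,n)^\varepsilon$ and converge to $X_\star$ with order $\min\{2,1+\theta\}$.
   Context: Notation. $\mathrm{St}(p,n)=\{X\in\mathbb{R}^{n\times p}: X^\top X=I_p\}$; $\mathrm{St}(p,n)^\varepsilon=\{X\in\mathbb{R}^{n\times p}:\|X^\top X-I_p\|_{\mathrm F}\le\varepsilon\}$; $B_r(X)$ is the open Frobenius-norm ball of radius $r$ centered at $X$; $\|\cdot\|$ is the operator norm of linear operators on $\mathbb{R}^{n\times p}$ (with the Frobenius norm). $\nabla f$ and $\nabla^2 f$ are the Euclidean gradient and Hessian ($\nabla^2 f(X)[V]$ is the Hessian applied to $V$). $\mathrm{skew}(A)=\tfrac12(A-A^\top)$. $\mathbb{R}^{n\times p}_*$ is the set of $n\times p$ matrices of full column rank. For $X\in\mathbb{R}^{n\times p}_*$, the layered manifold is $\mathrm{St}_{X^\top X}(p,n)=\{Z\in\mathbb{R}^{n\times p}:Z^\top Z=X^\top X\}$, with tangent space at $X$ given by $\mathrm{T}_X\mathrm{St}_{X^\top X}(p,n)=\{\xi\in\mathbb{R}^{n\times p}:\xi^\top X+X^\top\xi=0\}$. The set $\mathbb{R}^{n\times p}_*$ carries the Riemannian metric $g_Y(\xi,\eta)=\mathrm{tr}\big(\xi^\top(I_n-\tfrac12Y(Y^\top Y)^{-1}Y^\top)\eta(Y^\top Y)^{-1}\big)$,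 and $\mathrm{St}_{X^\top X}(p,n)$ is viewed as a Riemannian submanifold of $(\mathbb{R}^{n\times p}_*,g)$. The normal space at $X$ with respect to $g$ is $\mathrm{N}_X\mathrm{St}_{X^\top X}(p,n)=\{X(X^\top X)^{-1}S: S=S^\top\in\mathbb{R}^{p\times p}\}$. $\mathrm{grad} f(X)$ and $\mathrm{Hess} f(X)$ denote the Riemannian gradient and Riemannian Hessian (via the Levi-Civita connection) of the restriction of $f$ to $\mathrm{St}_{X^\top X}(p,n)$; one has $\mathrm{grad} f(X)=2\,\mathrm{skew}(\nabla f(X)X^\top)X$. At $X_\star\in\mathrm{St}(p,n)$ the layered manifold is $\mathrm{St}(p,n)$ itself; positive definiteness is with respect to $g_{X_\star}$. The operators $\mathcal{A}_{\mathrm T}(X)$ (acting on tangent vectors $V\in\mathrm{T}_X\mathrm{St}_{X^\top X}(p,n)$) and $\mathcal{A}_{\mathrm N}(X)$ (acting on normal vectors $V\in\mathrm{N}_X\mathrm{St}_{X^\top X}(p,n)$) are both given by the formula $$V\mapsto 2\,\mathrm{skew}\big(\nabla^2 f(X)[V]X^\top+\nabla f(X)V^\top\big)X,$$ whose values lie in $\mathrm{T}_X\mathrm{St}_{X^\top X}(p,n)$. Convergence with order $q>1$ means $X_k\to X_\star$ and there is a constant $C$ with $\|X_{k+1}-X_\star\|_{\mathrm F}\le C\|X_k-X_\star\|_{\mathrm F}^{q}$ for all $k$. *)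

theory Defs
  imports "HOL-Analysis.Analysis"
begin

text \<open>
  An \<open>n \<times> p\<close> real matrix is an element of \<^typ>\<open>real^'p^'n\<close>.  On this type \<^const>\<open>norm\<close>, \<^const>\<open>inner\<close>,
  \<^const>\<open>dist\<close> and \<^const>\<open>ball\<close> are the Frobenius ones, so \<^const>\<open>onorm\<close> is the operator norm with
  respect to the Frobenius norm.
\<close>

definition stiefel :: "(real^'p^'n) set" where
  "stiefel = {X. transpose X ** X = mat 1}"

definition stiefel_nbhd :: "real \<Rightarrow> (real^'p^'n) set" where
  "stiefel_nbhd \<epsilon> = {X. norm (transpose X ** X - mat 1) \<le> \<epsilon>}"

definition skew :: "real^'m^'m \<Rightarrow> real^'m^'m" where
  "skew A = (1/2) *\<^sub>R (A - transpose A)"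

definition local_minimizer_on :: "('a::metric_space \<Rightarrow> real) \<Rightarrow> 'a set \<Rightarrow> 'a \<Rightarrow> bool" where
  "local_minimizer_on f S x \<longleftrightarrow> x \<in> S \<and> (\<exists>r>0. \<forall>y\<in>S \<inter> ball x r. f x \<le> f y)"


subsection \<open>Euclidean derivatives\<close>

definition egrad :: "('a::real_inner \<Rightarrow> real) \<Rightarrow> 'a \<Rightarrow> 'a" where
  "egrad f X = (THE G. GDERIV f X :> G)"

definition ehess :: "('a::real_inner \<Rightarrow> real) \<Rightarrow> 'a \<Rightarrow> 'a \<Rightarrow> 'a" where
  "ehess f X = frechet_derivative (egrad f) (at X)"

text \<open>For a set that need not be open, being of class \<open>C\<^sup>2\<close> in it means being so on an open
  neighbourhood of it.\<close>

definition twice_continuously_differentiable_in :: "('a::real_inner \<Rightarrow> real) \<Rightarrow> 'a set \<Rightarrow> bool" where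
  "twice_continuously_differentiable_in f S \<longleftrightarrow>
     (\<exists>U. open U \<and> S \<subseteq> U \<and>
          (\<forall>X\<in>U. f differentiable (at X)) \<and>
          (\<forall>X\<in>U. egrad f differentiable (at X)) \<and>
          continuous_on U (\<lambda>X. Blinfun (ehess f X)))"


subsection \<open>Riemannian geometry of the layered manifolds\<close>

text \<open>Everything in this section is meant for \<open>X\<close>, \<open>Y\<close> of full column rank, where
  \<open>X\<^sup>T X\<close> is invertible.  The layered manifold through \<open>X\<close> is \<open>{Z. Z\<^sup>T Z = X\<^sup>T X}\<close>;
  \<open>layer_tangent X\<close> is its tangent space at \<open>X\<close>.\<close>

definition layer_tangent :: "real^'p^'n \<Rightarrow> (real^'p^'n) set" where
  "layer_tangent X = {\<xi>. transpose \<xi> ** X + transpose X ** \<xi> = 0}"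

definition gmetric :: "real^'p^'n \<Rightarrow> real^'p^'n \<Rightarrow> real^'p^'n \<Rightarrow> real" where
  "gmetric Y \<xi> \<eta> =
     trace (transpose \<xi>
            ** (mat 1 - (1/2) *\<^sub>R (Y ** matrix_inv (transpose Y ** Y) ** transpose Y))
            ** \<eta> ** matrix_inv (transpose Y ** Y))"

definition rgrad :: "(real^'p^'n \<Rightarrow> real) \<Rightarrow> real^'p^'n \<Rightarrow> real^'p^'n" where
  "rgrad f X = (THE G. G \<in> layer_tangent X \<and>
     (\<forall>\<xi>\<in>layer_tangent X. gmetric X G \<xi> = frechet_derivative f (at X) \<xi>))"

text \<open>The Levi-Civita connection of the metric on the open set of full-rank matrices, written as
  \<open>\<nabla>\<^sub>\<xi> \<eta> = D\<eta>[\<xi>] + \<Gamma>(\<xi>, \<eta>)\<close>.  Evaluated on constant vector fields, which commute and span every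
  tangent space, torsion-freeness says that \<open>\<Gamma>\<close> is symmetric, and compatibility with the metric is
  the displayed derivative rule; these determine \<open>\<Gamma>\<close>.\<close>

definition levi_civita_christoffel ::
    "real^'p^'n \<Rightarrow> real^'p^'n \<Rightarrow> real^'p^'n \<Rightarrow> real^'p^'n" where
  "levi_civita_christoffel Y = (THE \<Gamma>. bilinear \<Gamma> \<and>
     (\<forall>\<xi> \<eta>. \<Gamma> \<xi> \<eta> = \<Gamma> \<eta> \<xi>) \<and>
     (\<forall>\<zeta> \<xi> \<eta>. frechet_derivative (\<lambda>Z. gmetric Z \<xi> \<eta>) (at Y) \<zeta>
               = gmetric Y (\<Gamma> \<zeta> \<xi>) \<eta> + gmetric Y \<xi> (\<Gamma> \<zeta> \<eta>)))"

definition levi_civita ::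
    "(real^'p^'n \<Rightarrow> real^'p^'n) \<Rightarrow> real^'p^'n \<Rightarrow> real^'p^'n \<Rightarrow> real^'p^'n" where
  "levi_civita \<eta> Y \<xi> =
     frechet_derivative \<eta> (at Y) \<xi> + levi_civita_christoffel Y \<xi> (\<eta> Y)"

definition tangent_proj :: "real^'p^'n \<Rightarrow> real^'p^'n \<Rightarrow> real^'p^'n" where
  "tangent_proj X V = (THE W. W \<in> layer_tangent X \<and>
     (\<forall>\<xi>\<in>layer_tangent X. gmetric X (V - W) \<xi> = 0))"

text \<open>The Levi-Civita connection of a Riemannian submanifold is the tangential part of the ambient
  one, applied to any extension of the vector field.  Here \<^term>\<open>rgrad f\<close>, which at each \<open>Z\<close> is the
  gradient along the layer through \<open>Z\<close>, is itself defined on all full-rank matrices and extends the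
  gradient field of the layer through \<open>X\<close>.\<close>

definition rhess :: "(real^'p^'n \<Rightarrow> real) \<Rightarrow> real^'p^'n \<Rightarrow> real^'p^'n \<Rightarrow> real^'p^'n" where
  "rhess f X \<xi> = tangent_proj X (levi_civita (rgrad f) X \<xi>)"

definition rhess_pos_def :: "(real^'p^'n \<Rightarrow> real) \<Rightarrow> real^'p^'n \<Rightarrow> bool" where
  "rhess_pos_def f X \<longleftrightarrow>
     (\<forall>\<xi>\<in>layer_tangent X. \<xi> \<noteq> 0 \<longrightarrow> gmetric X (rhess f X \<xi>) \<xi> > 0)"


subsection \<open>The iteration\<close>

text \<open>One formula serves for both operators: restricted to \<^term>\<open>layer_tangent X\<close> it is
  \<open>\<A>\<^sub>T(X)\<close>, restricted to the normal space it is \<open>\<A>\<^sub>N(X)\<close>.\<close>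

definition layer_op :: "(real^'p^'n \<Rightarrow> real) \<Rightarrow> real^'p^'n \<Rightarrow> real^'p^'n \<Rightarrow> real^'p^'n" where
  "layer_op f X V =
     2 *\<^sub>R (skew (ehess f X V ** transpose X + egrad f X ** transpose V) ** X)"

definition normal_step :: "real^'p^'n \<Rightarrow> real^'p^'n" where
  "normal_step X = - (1/2) *\<^sub>R (X ** (transpose X ** X - mat 1))"

definition newton_rhs :: "(real^'p^'n \<Rightarrow> real) \<Rightarrow> real^'p^'n \<Rightarrow> real^'p^'n" where
  "newton_rhs f X = - rgrad f X - layer_op f X (normal_step X)"

definition newton_residual ::
    "(real^'p^'n \<Rightarrow> real) \<Rightarrow> real^'p^'n \<Rightarrow> real^'p^'n \<Rightarrow> real^'p^'n" where
  "newton_residual f X T = layer_op f X T - newton_rhs f X"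

text \<open>The inexact tangential step at the \<open>k\<close>-th iterate is any \<open>T k\<close> meeting the residual
  tolerance; it need not be a function of the iterate.\<close>

definition inexact_newton_sequence ::
    "(real^'p^'n \<Rightarrow> real) \<Rightarrow> real \<Rightarrow> real \<Rightarrow>
     (nat \<Rightarrow> real^'p^'n) \<Rightarrow> (nat \<Rightarrow> real^'p^'n) \<Rightarrow> bool" where
  "inexact_newton_sequence f \<zeta>max \<theta> X T \<longleftrightarrow>
     (\<forall>k. T k \<in> layer_tangent (X k) \<and>
          norm (newton_residual f (X k) (T k))
            \<le> min \<zeta>max (norm (newton_rhs f (X k)) powr \<theta>) * norm (newton_rhs f (X k)) \<and>
          X (Suc k) = X k + (T k + normal_step (X k)))"

definition converges_with_order ::
    "real \<Rightarrow> (nat \<Rightarrow> 'a::real_normed_vector) \<Rightarrow> 'a \<Rightarrow> bool" where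
  "converges_with_order q X L \<longleftrightarrow>
     X \<longlonglongrightarrow> L \<and> (\<exists>C. \<forall>k. norm (X (Suc k) - L) \<le> C * norm (X k - L) powr q)"

end

theory Submission
  imports Defs
begin

text \<open>
  The iteration is an inexact Newton method for the system \<open>grad f(X) = 0\<close>, \<open>X\<^sup>T X = I\<close>, and converges for
  the reason Newton's method does: the error of one step, seen through the linearized system, is
  quadratic apart from the residual, and the linearized system is uniformly injective near \<open>Xs\<close>.

  The linearization at \<open>X\<close> sends \<open>V\<close> to the pair \<open>(layer_op f X V, V\<^sup>T X + X\<^sup>T V)\<close>.  On the new error
  \<open>E' = X + T + N(X) - Xs\<close> its first component is \<open>layer_op f X (X - Xs) - grad f(X)\<close> plus the residual
  (\<open>newton_error_layer_op\<close>).  The first part is a Taylor remainder of the gradient field at a zero of it,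
  hence of second order; the residual is at most \<open>\<parallel>b(X)\<parallel>\<close> to the power \<open>1 + \<theta>\<close>, hence of order
  \<open>1 + \<theta>\<close> in the old error.  The second component is of second order because \<open>T\<close> is tangent and
  \<open>N\<close> is a Newton step for \<open>X\<^sup>T X = I\<close> (\<open>newton_error_gram\<close>).

  Injectivity at \<open>Xs\<close> is where nondegeneracy enters: the kernel of the second component is the
  tangent space, and on it \<open>layer_op f Xs\<close> is the Riemannian Hessian
  (\<open>rhess_eq_layer_op_at_critical_point\<close>), which is positive definite.  The resulting lower
  bound concerns a linear map on the whole matrix space, so it extends to nearby \<open>X\<close> by continuity
  (\<open>newton_operator_coercive\<close>), although the tangent spaces change.

  To identify the Hessian, the gradient, the tangential projection and the Christoffel form have to be
  computed, or shown to exist, from their defining properties.  The metric is positive definite at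
  full-rank matrices (\<open>gmetric_pos\<close>), which makes all of them unique; the gradient has the closed form
  \<open>2 skew(\<nabla>f(X) X\<^sup>T) X\<close> (\<open>rgrad_eq\<close>) and vanishes at the local minimizer, as curves given by the Cayley
  transform show (\<open>stiefel_critical\<close>); and the Koszul formula yields the Christoffel form
  (\<open>ex1_christoffel\<close>), which drops out at a critical point.
\<close>

section \<open>The Frobenius norm and matrix products\<close>

text \<open>Entrywise Cauchy--Schwarz: each entry of the product is an inner product of a row and a column.\<close>
lemma norm_matrix_mult_le:
  fixes A :: "real^'b^'a" and B :: "real^'c^'b"
  shows "norm (A ** B) \<le> norm A * norm B"
proof -
  have "(norm (A ** B))\<^sup>2 = (\<Sum>i\<in>UNIV. \<Sum>j\<in>UNIV. (A $ i \<bullet> column j B)\<^sup>2)"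
    by (simp only: power2_norm_eq_inner)
       (simp add: inner_vec_def matrix_matrix_mult_def column_def power2_eq_square)
  also have "\<dots> \<le> (\<Sum>i\<in>UNIV. \<Sum>j\<in>UNIV. (A $ i \<bullet> A $ i) * (column j B \<bullet> column j B))"
    by (intro sum_mono Cauchy_Schwarz_ineq)
  also have "\<dots> = (\<Sum>i\<in>UNIV. A $ i \<bullet> A $ i) * (\<Sum>j\<in>UNIV. column j B \<bullet> column j B)"
    by (simp add: sum_product)
  also have "(\<Sum>j\<in>UNIV. column j B \<bullet> column j B) = B \<bullet> B"
    by (simp add: inner_vec_def column_def) (rule sum.swap)
  also have "(\<Sum>i\<in>UNIV. A $ i \<bullet> A $ i) = A \<bullet> A"
    by (simp add: inner_vec_def)
  finally have "(norm (A ** B))\<^sup>2 \<le> (norm A * norm B)\<^sup>2"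
    by (simp add: power2_norm_eq_inner power_mult_distrib)
  then show ?thesis
    by (simp add: power2_le_iff_abs_le)
qed

lemma bounded_bilinear_matrix_mult:
  "bounded_bilinear ((**) :: real^'b^'a \<Rightarrow> real^'c^'b \<Rightarrow> real^'c^'a)"
proof (unfold_locales, goal_cases)
  case 5
  show ?case
    by (intro exI[of _ 1]) (simp add: norm_matrix_mult_le)
qed (simp_all add: vec_eq_iff matrix_matrix_mult_def algebra_simps sum.distrib sum_distrib_left)

lemmas matrix_mult_distribs =
  bounded_bilinear.add_left[OF bounded_bilinear_matrix_mult]
  bounded_bilinear.add_right[OF bounded_bilinear_matrix_mult]
  bounded_bilinear.diff_left[OF bounded_bilinear_matrix_mult]
  bounded_bilinear.diff_right[OF bounded_bilinear_matrix_mult]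
  bounded_bilinear.minus_left[OF bounded_bilinear_matrix_mult]
  bounded_bilinear.minus_right[OF bounded_bilinear_matrix_mult]
  bounded_bilinear.scaleR_left[OF bounded_bilinear_matrix_mult]
  bounded_bilinear.scaleR_right[OF bounded_bilinear_matrix_mult]

lemmas matrix_mult_zeros =
  bounded_bilinear.zero_left[OF bounded_bilinear_matrix_mult]
  bounded_bilinear.zero_right[OF bounded_bilinear_matrix_mult]

lemmas has_derivative_matrix_mult = bounded_bilinear.FDERIV[OF bounded_bilinear_matrix_mult]

lemma transpose_minus: "transpose (- A) = - transpose (A :: real^'b^'a)"
  and transpose_diff: "transpose (A - B) = transpose A - transpose (B :: real^'b^'a)"
  and transpose_add: "transpose (A + B) = transpose A + transpose (B :: real^'b^'a)"
  and transpose_zero: "transpose (0 :: real^'b^'a) = 0"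
  by (simp_all add: vec_eq_iff transpose_def)

lemmas transpose_distribs =
  transpose_add transpose_diff transpose_minus transpose_scalar transpose_zero matrix_transpose_mul

lemma inner_transpose: "transpose A \<bullet> transpose B = A \<bullet> (B :: real^'b^'a)"
  by (simp add: inner_vec_def transpose_def) (rule sum.swap)

lemma norm_transpose: "norm (transpose A) = norm (A :: real^'b^'a)"
  by (simp add: norm_eq_sqrt_inner inner_transpose)

lemma bounded_linear_transpose:
  "bounded_linear (transpose :: real^'b^'a \<Rightarrow> real^'a^'b)"
  by (rule bounded_linear_intro[where K = 1])
     (simp_all add: transpose_distribs norm_transpose)

lemmas has_derivative_transpose = bounded_linear.has_derivative[OF bounded_linear_transpose]

lemma inner_matrix_eq_trace: "A \<bullet> B = trace (transpose A ** (B :: real^'b^'a))"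
  by (simp add: inner_vec_def trace_def matrix_matrix_mult_def transpose_def) (rule sum.swap)

lemma inner_matrix_mult_left:
  fixes A :: "real^'b^'a" and B :: "real^'c^'b"
  shows "(A ** B) \<bullet> C = B \<bullet> (transpose A ** C)"
  by (simp add: inner_matrix_eq_trace matrix_transpose_mul matrix_mul_assoc)

lemma inner_matrix_mult_right:
  fixes A :: "real^'b^'a" and B :: "real^'c^'b"
  shows "(A ** B) \<bullet> C = A \<bullet> (C ** transpose B)"
proof -
  have "(A ** B) \<bullet> C = (transpose B ** transpose A) \<bullet> transpose C"
    by (metis inner_transpose matrix_transpose_mul)
  also have "\<dots> = transpose A \<bullet> transpose (C ** transpose B)"
    by (simp add: inner_matrix_mult_left matrix_transpose_mul)
  finally show ?thesis by (simp only: inner_transpose)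
qed

lemma two_skew: "2 *\<^sub>R skew A = A - transpose A"
  by (simp add: skew_def)

section \<open>The derivative of the matrix inverse\<close>

lemma matrix_inv_works:
  fixes A :: "real^'n^'n"
  assumes "invertible A"
  shows "A ** matrix_inv A = mat 1" "matrix_inv A ** A = mat 1"
proof -
  have "A ** matrix_inv A = mat 1 \<and> matrix_inv A ** A = mat 1"
    unfolding matrix_inv_def by (rule someI_ex) (use assms in \<open>simp add: invertible_def\<close>)
  then show "A ** matrix_inv A = mat 1" "matrix_inv A ** A = mat 1" by auto
qed

lemma matrix_inv_eqI:
  fixes A :: "real^'n^'n"
  assumes "A ** B = mat 1" "B ** A = mat 1"
  shows "matrix_inv A = B"
proof -
  have "invertible A" using assms unfolding invertible_def by blast
  then have "matrix_inv A = matrix_inv A ** (A ** B)" by (simp add: assms)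
  also have "\<dots> = B" by (simp add: matrix_mul_assoc matrix_inv_works \<open>invertible A\<close>)
  finally show ?thesis .
qed

lemma matrix_inv_mult:
  fixes A B :: "real^'n^'n"
  assumes "invertible A" "invertible B"
  shows "matrix_inv (A ** B) = matrix_inv B ** matrix_inv A"
proof (rule matrix_inv_eqI)
  have "A ** B ** (matrix_inv B ** matrix_inv A) = A ** (B ** matrix_inv B) ** matrix_inv A"
    by (simp only: matrix_mul_assoc)
  then show "A ** B ** (matrix_inv B ** matrix_inv A) = mat 1"
    by (simp add: matrix_inv_works assms)
  have "matrix_inv B ** matrix_inv A ** (A ** B) = matrix_inv B ** (matrix_inv A ** A) ** B"
    by (simp only: matrix_mul_assoc)
  then show "matrix_inv B ** matrix_inv A ** (A ** B) = mat 1"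
    by (simp add: matrix_inv_works assms)
qed

lemma transpose_matrix_inv:
  fixes A :: "real^'n^'n"
  assumes "invertible A"
  shows "transpose (matrix_inv A) = matrix_inv (transpose A)"
  by (rule matrix_inv_eqI[symmetric])
     (metis matrix_transpose_mul matrix_inv_works[OF assms] transpose_mat)+

text \<open>A perturbation of relative size at most one half keeps a matrix invertible: a nonzero \<open>D\<close> with
  \<open>B D = 0\<close> would be reproduced by \<open>- A\<inverse> (B - A)\<close>, which at least halves norms.  The resolvent
  identity \<open>A\<inverse> = B\<inverse> + A\<inverse> (B - A) B\<inverse>\<close> then bounds the inverse.\<close>
lemma invertible_near:
  fixes A B :: "real^'n^'n"
  assumes A: "invertible A" and small: "norm (B - A) * norm (matrix_inv A) \<le> 1/2"
  shows "invertible B" "norm (matrix_inv B) \<le> 2 * norm (matrix_inv A)"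
proof -
  let ?C = "matrix_inv A ** (B - A)"
  have C: "norm ?C \<le> 1/2"
    using norm_matrix_mult_le[of "matrix_inv A" "B - A"] small by (simp add: mult.commute)
  have fact: "D = - (?C ** D)" if D: "B ** D = 0" for D :: "real^'n^'n"
    using D by (simp add: matrix_mult_distribs matrix_mult_zeros matrix_mul_assoc[symmetric])
       (simp add: matrix_mul_assoc matrix_inv_works[OF A])
  have "x = 0" if x: "B *v x = 0" for x
  proof -
    \<comment> \<open>Repeating the vector \<open>x\<close> as every column turns a kernel vector into a square matrix,
      to which the Frobenius bound applies directly.\<close>
    define D :: "real^'n^'n" where "D = columnvector x ** (\<chi> i j. 1)"
    have BD: "B ** D = 0"
    proof -
      have "B ** columnvector x = columnvector (B *v x)"
        by (simp add: vec_eq_iff columnvector_def matrix_matrix_mult_def matrix_vector_mult_def)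
      then show ?thesis
        by (simp add: D_def matrix_mul_assoc x)
           (simp add: columnvector_def matrix_matrix_mult_def vec_eq_iff)
    qed
    have "norm D \<le> 1/2 * norm D"
    proof -
      have "norm D = norm (?C ** D)" by (subst fact[OF BD]) (rule norm_minus_cancel)
      also have "\<dots> \<le> norm ?C * norm D" by (rule norm_matrix_mult_le)
      also have "\<dots> \<le> 1/2 * norm D" by (rule mult_right_mono[OF C norm_ge_zero])
      finally show ?thesis .
    qed
    then have "D = 0" by simp
    then have "(\<Sum>k\<in>(UNIV::unit set). x $ i) = 0" for i
      unfolding D_def columnvector_def by (simp add: vec_eq_iff matrix_matrix_mult_def)
    then show ?thesis by (simp add: vec_eq_iff)
  qed
  then show inv: "invertible B"
    by (simp add: invertible_left_inverse matrix_left_invertible_ker)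
  have "matrix_inv A = matrix_inv A ** (B ** matrix_inv B)"
    by (simp add: matrix_inv_works[OF inv])
  also have "\<dots> = matrix_inv B + ?C ** matrix_inv B"
    by (simp add: matrix_mult_distribs matrix_mul_assoc matrix_inv_works[OF A])
  finally have "norm (matrix_inv B) \<le> norm (matrix_inv A) + norm (?C ** matrix_inv B)"
    by (metis add_diff_cancel_right' norm_triangle_ineq4)
  also have "norm (?C ** matrix_inv B) \<le> 1/2 * norm (matrix_inv B)"
    using norm_matrix_mult_le[of ?C "matrix_inv B"] mult_right_mono[OF C, of "norm (matrix_inv B)"]
    by simp
  finally show "norm (matrix_inv B) \<le> 2 * norm (matrix_inv A)" by simp
qed

lemma eventually_invertible:
  fixes A :: "real^'n^'n"
  assumes A: "invertible A"
  shows "eventually (\<lambda>B. norm (B - A) * norm (matrix_inv A) \<le> 1/2) (nhds A)"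
proof -
  have "((\<lambda>B. norm (B - A) * norm (matrix_inv A)) \<longlongrightarrow> norm (A - A) * norm (matrix_inv A)) (nhds A)"
    by (intro tendsto_intros filterlim_ident)
  then have "eventually (\<lambda>B. norm (B - A) * norm (matrix_inv A) < 1/2) (nhds A)"
    by (rule order_tendstoD) simp
  then show ?thesis by eventually_elim simp
qed

text \<open>The remainder of the linear approximation is exactly
  \<open>B\<inverse> (B - A) A\<inverse> (B - A) A\<inverse>\<close>, which is quadratic in \<open>B - A\<close> as long as \<open>B\<inverse>\<close> stays bounded.\<close>
lemma has_derivative_matrix_inv:
  fixes A :: "real^'n^'n"
  assumes A: "invertible A"
  shows "(matrix_inv has_derivative (\<lambda>H. - (matrix_inv A ** H ** matrix_inv A))) (at A)"
proof -
  let ?K = "matrix_inv A"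
  have lin: "bounded_linear (\<lambda>H. - (?K ** H ** ?K))"
    by (intro bounded_linear_minus
          bounded_linear_compose[OF bounded_bilinear.bounded_linear_left[OF bounded_bilinear_matrix_mult]]
          bounded_bilinear.bounded_linear_right[OF bounded_bilinear_matrix_mult])
  have remainder: "norm (matrix_inv B - ?K - - (?K ** (B - A) ** ?K)) / norm (B - A)
      \<le> 2 * norm ?K ^ 3 * norm (B - A)"
    if "norm (B - A) * norm ?K \<le> 1/2" for B
  proof -
    note B = invertible_near[OF A that]
    have "matrix_inv B - ?K - - (?K ** (B - A) ** ?K)
        = matrix_inv B ** ((B - A) ** ?K ** (B - A) ** ?K)"
      by (simp add: matrix_mult_distribs matrix_mul_assoc matrix_inv_works[OF A] matrix_inv_works[OF B(1)])
    then have "norm (matrix_inv B - ?K - - (?K ** (B - A) ** ?K))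
        \<le> norm (matrix_inv B) * (norm (B - A) * norm ?K * norm (B - A) * norm ?K)"
      by (auto intro!: order_trans[OF norm_matrix_mult_le] mult_left_mono mult_right_mono)
    also have "\<dots> \<le> (2 * norm ?K) * (norm (B - A) * norm ?K * norm (B - A) * norm ?K)"
      by (intro mult_right_mono B) auto
    finally have "norm (matrix_inv B - ?K - - (?K ** (B - A) ** ?K))
        \<le> 2 * norm ?K ^ 3 * norm (B - A) * norm (B - A)"
      by (simp add: power3_eq_cube mult_ac)
    then show ?thesis
      by (cases "B = A") (auto simp: field_simps)
  qed
  have "((\<lambda>B. 2 * norm ?K ^ 3 * norm (B - A)) \<longlongrightarrow> 2 * norm ?K ^ 3 * norm (A - A)) (at A)"
    by (intro tendsto_intros)
  then have lim: "((\<lambda>B. 2 * norm ?K ^ 3 * norm (B - A)) \<longlongrightarrow> 0) (at A)" by simp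
  have "((\<lambda>B. norm (matrix_inv B - ?K - - (?K ** (B - A) ** ?K)) / norm (B - A)) \<longlongrightarrow> 0) (at A)"
  proof (rule tendsto_sandwich[OF _ _ tendsto_const lim])
    have "eventually (\<lambda>B. norm (B - A) * norm ?K \<le> 1/2) (at A)"
      using eventually_invertible[OF A] by (simp add: eventually_at_filter eventually_mono)
    then show "eventually (\<lambda>B. norm (matrix_inv B - ?K - - (?K ** (B - A) ** ?K)) / norm (B - A)
        \<le> 2 * norm ?K ^ 3 * norm (B - A)) (at A)"
      by eventually_elim (rule remainder)
  qed simp
  then show ?thesis
    by (simp add: has_derivative_iff_norm lin)
qed

section \<open>The metric and the Riemannian gradient\<close>

text \<open>Written with the Frobenius inner product instead of the trace, the metric can be manipulated by
  moving factors across the inner product by transposition.\<close>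
lemma gmetric_eq_inner:
  "gmetric Y \<xi> \<eta> = \<xi> \<bullet> ((mat 1 - (1/2) *\<^sub>R (Y ** matrix_inv (transpose Y ** Y) ** transpose Y))
      ** \<eta> ** matrix_inv (transpose Y ** Y))"
  by (simp add: gmetric_def inner_matrix_eq_trace matrix_mul_assoc)

lemma gmetric_add_left: "gmetric X (\<xi> + \<xi>') \<eta> = gmetric X \<xi> \<eta> + gmetric X \<xi>' \<eta>"
  and gmetric_add_right: "gmetric X \<xi> (\<eta> + \<eta>') = gmetric X \<xi> \<eta> + gmetric X \<xi> \<eta>'"
  and gmetric_diff_left: "gmetric X (\<xi> - \<xi>') \<eta> = gmetric X \<xi> \<eta> - gmetric X \<xi>' \<eta>"
  and gmetric_diff_right: "gmetric X \<xi> (\<eta> - \<eta>') = gmetric X \<xi> \<eta> - gmetric X \<xi> \<eta>'"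
  and gmetric_scaleR_left: "gmetric X (c *\<^sub>R \<xi>) \<eta> = c * gmetric X \<xi> \<eta>"
  and gmetric_scaleR_right: "gmetric X \<xi> (c *\<^sub>R \<eta>) = c * gmetric X \<xi> \<eta>"
  by (simp_all add: gmetric_eq_inner inner_add_left inner_add_right inner_diff_left inner_diff_right
        matrix_mult_distribs algebra_simps)

lemma gmetric_zero_left [simp]: "gmetric X 0 \<eta> = 0"
  by (simp add: gmetric_eq_inner)

lemmas gmetric_distribs = gmetric_add_left gmetric_add_right gmetric_diff_left gmetric_diff_right
  gmetric_scaleR_left gmetric_scaleR_right

lemma transpose_inv_gram:
  assumes "invertible (transpose X ** (X :: real^'p^'n))"
  shows "transpose (matrix_inv (transpose X ** X)) = matrix_inv (transpose X ** X)"
  using transpose_matrix_inv[OF assms] by (simp add: matrix_transpose_mul)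

lemma gmetric_commute:
  assumes X: "invertible (transpose X ** (X :: real^'p^'n))"
  shows "gmetric X \<xi> \<eta> = gmetric X \<eta> \<xi>"
proof -
  let ?K = "matrix_inv (transpose X ** X)"
  let ?M = "mat 1 - (1/2) *\<^sub>R (X ** ?K ** transpose X)"
  have M: "transpose ?M = ?M"
    by (simp add: transpose_distribs transpose_inv_gram[OF X] matrix_mul_assoc)
  have "gmetric X \<xi> \<eta> = (?M ** \<eta> ** ?K) \<bullet> \<xi>"
    by (simp add: gmetric_eq_inner inner_commute)
  also have "\<dots> = (?M ** \<eta>) \<bullet> (\<xi> ** transpose ?K)"
    by (rule inner_matrix_mult_right)
  also have "\<dots> = \<eta> \<bullet> (transpose ?M ** (\<xi> ** transpose ?K))"
    by (rule inner_matrix_mult_left)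
  also have "\<dots> = gmetric X \<eta> \<xi>"
    by (simp add: M transpose_inv_gram[OF X] gmetric_eq_inner matrix_mul_assoc)
  finally show ?thesis .
qed

text \<open>Put \<open>K = (X\<^sup>T X)\<inverse>\<close>, so that \<open>P = X K X\<^sup>T\<close> is the orthogonal projector onto the column space of
  \<open>X\<close>.  For \<open>\<eta> = \<xi> K X\<^sup>T\<close> the metric is \<open>\<parallel>\<eta>\<parallel>\<^sup>2 - \<parallel>P \<eta>\<parallel>\<^sup>2 / 2 \<ge> \<parallel>\<eta>\<parallel>\<^sup>2 / 2\<close>, and \<open>\<eta> X = \<xi>\<close> shows that
  \<open>\<eta>\<close> vanishes only together with \<open>\<xi>\<close>.\<close>
lemma gmetric_pos:
  assumes X: "invertible (transpose X ** (X :: real^'p^'n))" and "\<xi> \<noteq> 0"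
  shows "gmetric X \<xi> \<xi> > 0"
proof -
  let ?K = "matrix_inv (transpose X ** X)"
  let ?P = "X ** ?K ** transpose X"
  define \<eta> where "\<eta> = \<xi> ** ?K ** transpose X"
  have \<eta>X: "\<eta> ** X = \<xi>"
    by (simp add: \<eta>_def matrix_mul_assoc[symmetric] matrix_inv_works[OF X])
  have P: "transpose ?P = ?P" "?P ** ?P = ?P"
    by (simp_all add: transpose_distribs transpose_inv_gram[OF X] matrix_mul_assoc)
       (simp add: matrix_mul_assoc[symmetric], simp add: matrix_mul_assoc matrix_inv_works[OF X])
  have "gmetric X \<xi> \<xi> = (\<eta> ** X) \<bullet> ((mat 1 - (1/2) *\<^sub>R ?P) ** \<xi> ** ?K)"
    by (simp add: gmetric_eq_inner \<eta>X)
  also have "\<dots> = \<eta> \<bullet> ((mat 1 - (1/2) *\<^sub>R ?P) ** \<eta>)"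
    by (simp add: inner_matrix_mult_right \<eta>_def matrix_mul_assoc)
  also have "\<dots> = \<eta> \<bullet> \<eta> - (1/2) * (\<eta> \<bullet> (?P ** \<eta>))"
    by (simp add: matrix_mult_distribs inner_diff_right)
  finally have g: "gmetric X \<xi> \<xi> = \<eta> \<bullet> \<eta> - (1/2) * (\<eta> \<bullet> (?P ** \<eta>))" .
  have PP: "\<eta> \<bullet> (?P ** \<eta>) = (?P ** \<eta>) \<bullet> (?P ** \<eta>)"
    by (simp only: inner_matrix_mult_left P(1)) (simp only: matrix_mul_assoc[of ?P ?P] P(2))
  have "(norm (?P ** \<eta>))\<^sup>2 \<le> norm \<eta> * norm (?P ** \<eta>)"
    using PP norm_cauchy_schwarz[of \<eta> "?P ** \<eta>"] by (simp add: power2_norm_eq_inner)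
  then have "norm (?P ** \<eta>) \<le> norm \<eta>"
    by (cases "norm (?P ** \<eta>) = 0") (simp_all add: power2_eq_square)
  then have "\<eta> \<bullet> (?P ** \<eta>) \<le> \<eta> \<bullet> \<eta>"
    by (simp add: PP norm_le)
  moreover have "\<eta> \<noteq> 0"
    using \<eta>X \<open>\<xi> \<noteq> 0\<close> by (auto simp: matrix_mult_zeros)
  then have "\<eta> \<bullet> \<eta> > 0" by simp
  ultimately show ?thesis unfolding g by linarith
qed

lemma layer_tangent_iff: "\<xi> \<in> layer_tangent X \<longleftrightarrow> transpose \<xi> ** X = - (transpose X ** \<xi>)"
  by (simp add: layer_tangent_def eq_neg_iff_add_eq_0)

lemma layer_tangent_diff:
  "\<xi> \<in> layer_tangent X \<Longrightarrow> \<eta> \<in> layer_tangent X \<Longrightarrow> \<xi> - \<eta> \<in> layer_tangent X"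
  by (simp add: layer_tangent_iff matrix_mult_distribs transpose_distribs)

lemma skew_mult_in_layer_tangent: "(A - transpose A) ** X \<in> layer_tangent X"
  by (simp add: layer_tangent_iff matrix_mult_distribs transpose_distribs matrix_mul_assoc)

text \<open>Positive definiteness makes the descriptions of \<^const>\<open>rgrad\<close> and \<^const>\<open>tangent_proj\<close> unique; this is
  how both definite descriptions are resolved.\<close>
lemma layer_tangent_eqI:
  assumes X: "invertible (transpose X ** (X :: real^'p^'n))"
    and "V \<in> layer_tangent X" "W \<in> layer_tangent X"
    and eq: "\<And>\<xi>. \<xi> \<in> layer_tangent X \<Longrightarrow> gmetric X V \<xi> = gmetric X W \<xi>"
  shows "V = W"
proof -
  have "gmetric X (V - W) (V - W) = 0"
    using eq[of "V - W"] assms(2,3) by (simp add: gmetric_diff_left layer_tangent_diff)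
  then show ?thesis
    using gmetric_pos[OF X, of "V - W"] by fastforce
qed

lemma tangent_proj_eq_self:
  assumes X: "invertible (transpose X ** (X :: real^'p^'n))" and V: "V \<in> layer_tangent X"
  shows "tangent_proj X V = V"
  unfolding tangent_proj_def
proof (rule the_equality)
  show "V \<in> layer_tangent X \<and> (\<forall>\<xi>\<in>layer_tangent X. gmetric X (V - V) \<xi> = 0)"
    using V by simp
next
  fix W assume "W \<in> layer_tangent X \<and> (\<forall>\<xi>\<in>layer_tangent X. gmetric X (V - W) \<xi> = 0)"
  then show "W = V"
    by (intro layer_tangent_eqI[OF X]) (auto simp: V gmetric_diff_left)
qed

text \<open>The Riesz representative of the derivative is the unique gradient.\<close>
lemma has_derivative_egrad:
  fixes f :: "'a::euclidean_space \<Rightarrow> real"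
  assumes "f differentiable (at X)"
  shows "(f has_derivative (\<lambda>h. h \<bullet> egrad f X)) (at X)"
proof -
  obtain f' where f': "(f has_derivative f') (at X)"
    using assms by (auto simp: differentiable_def)
  have lin: "linear f'" using f' by (rule has_derivative_linear)
  define G where "G = adjoint f' 1"
  have "f' = (\<lambda>h. h \<bullet> G)"
    using adjoint_works[OF lin, of _ 1] by (simp add: G_def fun_eq_iff)
  then have G: "GDERIV f X :> G"
    using f' by (simp add: gderiv_def)
  have "GDERIV f X :> egrad f X"
    unfolding egrad_def
  proof (rule theI)
    show "GDERIV f X :> G" by (rule G)
  next
    fix G' assume "GDERIV f X :> G'"
    then have "(\<lambda>h. h \<bullet> G') = (\<lambda>h. h \<bullet> G)"
      using G unfolding gderiv_def by (rule has_derivative_unique)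
    then show "G' = G" by (metis inner_commute vector_eq_ldot)
  qed
  then show ?thesis by (simp add: gderiv_def)
qed

text \<open>With \<open>D = \<nabla>f(X)\<close>, \<open>G = (D X\<^sup>T - X D\<^sup>T) X\<close> and a tangent \<open>\<xi>\<close>, the matrix \<open>A = X\<^sup>T \<xi>\<close> is skew.
  Expanding \<open>g(G, \<xi>)\<close> gives \<open>\<langle>D, \<xi>\<rangle>\<close> plus multiples of \<open>\<langle>D\<^sup>T X, A K\<rangle>\<close> and \<open>\<langle>D, X K A\<rangle>\<close>.  Skewness of
  \<open>A\<close> makes these two numbers opposite to each other (\<open>flip\<close>), and the factor one half in the metric is
  the one for which they cancel.\<close>
lemma rgrad_eq:
  fixes f :: "real^'p^'n \<Rightarrow> real"
  assumes X: "invertible (transpose X ** X)" and f: "f differentiable (at X)"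
  shows "rgrad f X = 2 *\<^sub>R skew (egrad f X ** transpose X) ** X"
proof -
  let ?K = "matrix_inv (transpose X ** X)"
  define D where "D = egrad f X"
  define G where "G = (D ** transpose X - X ** transpose D) ** X"
  have G_eq: "G = 2 *\<^sub>R skew (egrad f X ** transpose X) ** X"
    by (simp add: G_def D_def two_skew transpose_distribs)
  have tangent: "G \<in> layer_tangent X"
    using skew_mult_in_layer_tangent[of "D ** transpose X" X] by (simp add: G_def transpose_distribs)
  have KX: "B ** ?K ** transpose X ** X = B" for B :: "real^'p^'n"
    by (metis matrix_mul_assoc matrix_inv_works(2)[OF X] matrix_mul_rid)
  have XK': "transpose X ** X ** ?K ** B = B" for B :: "real^'p^'p"
    by (simp add: matrix_inv_works[OF X])
  have rep: "gmetric X G \<xi> = \<xi> \<bullet> D" if "\<xi> \<in> layer_tangent X" for \<xi>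
  proof -
    define A where "A = transpose X ** \<xi>"
    have A: "transpose A = - A"
      using that by (simp add: A_def layer_tangent_iff transpose_distribs)
    have flip: "(transpose D ** X) \<bullet> (A ** ?K) = - (D \<bullet> (X ** ?K ** A))"
    proof -
      have "(transpose D ** X) \<bullet> (A ** ?K) = transpose (transpose D ** X) \<bullet> transpose (A ** ?K)"
        by (simp only: inner_transpose)
      also have "\<dots> = - ((transpose X ** D) \<bullet> (?K ** A))"
        by (simp add: matrix_transpose_mul transpose_inv_gram[OF X] A matrix_mult_distribs)
      also have "\<dots> = - (D \<bullet> (X ** ?K ** A))"
        by (simp add: inner_matrix_mult_left matrix_mul_assoc)
      finally show ?thesis .
    qed
    have 1: "G \<bullet> (\<xi> ** ?K) = D \<bullet> \<xi> - (transpose D ** X) \<bullet> (A ** ?K)"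
    proof -
      have "(D ** transpose X ** X) \<bullet> (\<xi> ** ?K) = D \<bullet> \<xi>"
        by (simp only: inner_matrix_mult_right transpose_transpose KX)
      moreover have "(X ** transpose D ** X) \<bullet> (\<xi> ** ?K) = (transpose D ** X) \<bullet> (A ** ?K)"
        by (simp add: matrix_mul_assoc[symmetric] inner_matrix_mult_left A_def)
      ultimately show ?thesis by (simp add: G_def matrix_mult_distribs inner_diff_left)
    qed
    have 2: "G \<bullet> (X ** ?K ** A ** ?K) = D \<bullet> (X ** ?K ** A) - (transpose D ** X) \<bullet> (A ** ?K)"
    proof -
      have "(D ** transpose X ** X) \<bullet> (X ** ?K ** A ** ?K) = D \<bullet> (X ** ?K ** A)"
        by (simp only: inner_matrix_mult_right transpose_transpose KX)
      moreover have "(X ** transpose D ** X) \<bullet> (X ** ?K ** A ** ?K)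
          = (transpose D ** X) \<bullet> (transpose X ** (X ** ?K ** A ** ?K))"
        by (simp only: matrix_mul_assoc[symmetric, of X] inner_matrix_mult_left)
      moreover have "transpose X ** (X ** ?K ** A ** ?K) = A ** ?K"
        by (simp only: matrix_mul_assoc XK')
      ultimately show ?thesis by (simp add: G_def matrix_mult_distribs inner_diff_left)
    qed
    have "gmetric X G \<xi> = G \<bullet> (\<xi> ** ?K) - (1/2) * (G \<bullet> (X ** ?K ** A ** ?K))"
      by (simp add: gmetric_eq_inner matrix_mult_distribs inner_diff_right A_def matrix_mul_assoc)
    also have "\<dots> = \<xi> \<bullet> D"
      unfolding 1 2 flip by (simp add: inner_commute)
    finally show ?thesis .
  qed
  have Df: "frechet_derivative f (at X) = (\<lambda>h. h \<bullet> D)"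
    using frechet_derivative_at[OF has_derivative_egrad[OF f]] by (simp add: D_def)
  have "rgrad f X = G"
    unfolding rgrad_def Df
  proof (rule the_equality)
    show "G \<in> layer_tangent X \<and> (\<forall>\<xi>\<in>layer_tangent X. gmetric X G \<xi> = \<xi> \<bullet> D)"
      using tangent rep by simp
  next
    fix G' assume "G' \<in> layer_tangent X \<and> (\<forall>\<xi>\<in>layer_tangent X. gmetric X G' \<xi> = \<xi> \<bullet> D)"
    then show "G' = G"
      by (intro layer_tangent_eqI[OF X]) (auto simp: tangent rep)
  qed
  then show ?thesis by (simp add: G_eq)
qed

section \<open>Critical points on the Stiefel manifold\<close>

text \<open>For a skew matrix \<open>W\<close> the Cayley transform \<open>(I - t W / 2)\<inverse> (I + t W / 2)\<close> is orthogonal, so it moves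
  \<open>X\<close> along a curve in the Stiefel manifold with velocity \<open>W X\<close>.  Choosing
  \<open>W = D X\<^sup>T - X D\<^sup>T\<close> for \<open>D = \<nabla>f(X)\<close>, the derivative of \<open>f\<close> along the curve is \<open>\<parallel>W\<parallel>\<^sup>2 / 2\<close>, which must
  vanish at a minimizer.\<close>
lemma stiefel_critical:
  fixes f :: "real^'p^'n \<Rightarrow> real"
  assumes lm: "local_minimizer_on f stiefel X" and f: "f differentiable (at X)"
  shows "skew (egrad f X ** transpose X) = 0"
proof -
  define D where "D = egrad f X"
  define W where "W = D ** transpose X - X ** transpose D"
  define A where "A t = mat 1 - (t/2) *\<^sub>R W" for t
  define B where "B t = mat 1 + (t/2) *\<^sub>R W" for t
  define c where "c t = matrix_inv (A t) ** B t ** X" for t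
  have W: "transpose W = - W" by (simp add: W_def transpose_distribs)
  obtain r where r: "r > 0" "\<And>Y. Y \<in> stiefel \<Longrightarrow> Y \<in> ball X r \<Longrightarrow> f X \<le> f Y" and XX: "transpose X ** X = mat 1"
    using lm by (auto simp: local_minimizer_on_def stiefel_def)
  have I: "invertible (mat 1 :: real^'n^'n)" "matrix_inv (mat 1 :: real^'n^'n) = mat 1"
    by (auto simp: invertible_def intro: matrix_inv_eqI)
  have A0: "A 0 = mat 1" by (simp add: A_def)
  have dA: "(A has_derivative (\<lambda>t. - ((t/2) *\<^sub>R W))) (at 0)"
    unfolding A_def by (auto intro!: derivative_eq_intros)
  have dB: "(B has_derivative (\<lambda>t. (t/2) *\<^sub>R W)) (at 0)"
    unfolding B_def by (auto intro!: derivative_eq_intros)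
  have dinv: "((\<lambda>t. matrix_inv (A t)) has_derivative (\<lambda>t. (t/2) *\<^sub>R W)) (at 0)"
    using has_derivative_compose[OF dA, of matrix_inv, unfolded A0, OF has_derivative_matrix_inv[OF I(1)]]
    by (simp add: I matrix_mult_distribs)
  have c0: "c 0 = X" by (simp add: c_def A_def B_def I)
  have dc: "(c has_derivative (\<lambda>t. t *\<^sub>R (W ** X))) (at 0)"
  proof -
    have "((\<lambda>t. matrix_inv (A t) ** B t) has_derivative (\<lambda>t. t *\<^sub>R W)) (at 0)"
      by (rule has_derivative_eq_rhs[OF has_derivative_matrix_mult[OF dinv dB]])
         (simp add: A0 B_def I scaleR_add_left[symmetric])
    from has_derivative_matrix_mult[OF this has_derivative_const[of X]] show ?thesis
      unfolding c_def by (simp add: matrix_mult_zeros matrix_mult_distribs)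
  qed
  have c_stiefel: "c t \<in> stiefel" if inv: "invertible (A t)" for t
  proof -
    have tA: "transpose (A t) = B t" "transpose (B t) = A t"
      by (simp_all add: A_def B_def transpose_distribs W)
    have invB: "invertible (B t)" using inv tA transpose_invertible by metis
    have comm: "A t ** B t = B t ** A t"
      unfolding A_def B_def
      by (simp only: matrix_mult_distribs matrix_mul_lid matrix_mul_rid scaleR_add_right
            scaleR_diff_right) (simp only: algebra_simps)
    have comm_inv: "matrix_inv (B t) ** matrix_inv (A t) = matrix_inv (A t) ** matrix_inv (B t)"
      using comm matrix_inv_mult[OF inv invB] matrix_inv_mult[OF invB inv] by simp
    have "transpose (c t) ** c t = transpose X ** A t ** (matrix_inv (B t) ** matrix_inv (A t)) ** B t ** X"
      by (simp add: c_def matrix_transpose_mul transpose_matrix_inv[OF inv] tA matrix_mul_assoc)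
    also have "\<dots> = transpose X ** (A t ** matrix_inv (A t)) ** (matrix_inv (B t) ** B t) ** X"
      unfolding comm_inv by (simp only: matrix_mul_assoc)
    also have "\<dots> = mat 1"
      by (simp add: matrix_inv_works[OF inv] matrix_inv_works[OF invB] XX)
    finally show ?thesis by (simp add: stiefel_def)
  qed
  have df: "((\<lambda>t. f (c t)) has_derivative (\<lambda>t. (t *\<^sub>R (W ** X)) \<bullet> D)) (at 0)"
    using has_derivative_compose[OF dc, of f, unfolded c0, OF has_derivative_egrad[OF f]]
    by (simp add: D_def)
  then have DERIV: "((\<lambda>t. f (c t)) has_real_derivative ((W ** X) \<bullet> D)) (at 0)"
    by (rule has_derivative_imp_has_field_derivative) simp
  have "eventually (\<lambda>t. f (c 0) \<le> f (c t)) (nhds 0)"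
  proof -
    have "(A \<longlongrightarrow> mat 1) (nhds 0)"
      using tendsto_at_iff_tendsto_nhds[THEN iffD1, OF isContD[OF has_derivative_continuous[OF dA]]]
      by (simp only: A0)
    then have "eventually (\<lambda>t. norm (A t - mat 1) * norm (matrix_inv (mat 1 :: real^'n^'n)) \<le> 1/2) (nhds 0)"
      by (rule eventually_compose_filterlim[OF eventually_invertible[OF I(1)]])
    then have 1: "eventually (\<lambda>t. c t \<in> stiefel) (nhds 0)"
      by eventually_elim (rule c_stiefel[OF invertible_near(1)[OF I(1)]])
    have "(c \<longlongrightarrow> X) (nhds 0)"
      using tendsto_at_iff_tendsto_nhds[THEN iffD1, OF isContD[OF has_derivative_continuous[OF dc]]]
      by (simp only: c0)
    then have "eventually (\<lambda>t. c t \<in> ball X r) (nhds 0)"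
      by (rule topological_tendstoD) (simp_all add: r(1))
    with 1 show ?thesis
      by eventually_elim (simp add: c0 r(2))
  qed
  then obtain d where "d > 0" "\<And>t. dist t 0 < d \<Longrightarrow> f (c 0) \<le> f (c t)"
    by (auto simp: eventually_nhds_metric)
  then have "(W ** X) \<bullet> D = 0"
    by (intro DERIV_local_min[OF DERIV]) (auto simp: dist_real_def)
  moreover have "(W ** X) \<bullet> D = W \<bullet> (D ** transpose X)"
    by (simp only: inner_matrix_mult_right)
  moreover have "W \<bullet> (D ** transpose X) = - (W \<bullet> (X ** transpose D))"
    using inner_transpose[of W "D ** transpose X"] by (simp add: W transpose_distribs)
  ultimately have "W \<bullet> W = 0"
    by (subst (2) W_def) (simp add: inner_diff_right)
  then show ?thesis
    by (simp add: skew_def W_def D_def transpose_distribs)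
qed


section \<open>The Levi-Civita connection and the Riemannian Hessian\<close>

text \<open>The fundamental theorem of Riemannian geometry at a single point, for constant vector fields.  The
  Koszul formula, here \<open>\<kappa>\<close>, is forced by symmetry and compatibility, and nondegeneracy of \<open>g\<close> turns
  it into a vector.\<close>
lemma ex1_christoffel:
  fixes g :: "'a::euclidean_space \<Rightarrow> 'a \<Rightarrow> real" and D :: "'a \<Rightarrow> 'a \<Rightarrow> 'a \<Rightarrow> real"
  assumes g: "bilinear g" and g_commute: "\<And>v w. g v w = g w v" and g_pos: "\<And>v. v \<noteq> 0 \<Longrightarrow> g v v > 0"
    and D: "\<And>\<xi> \<eta>. linear (\<lambda>\<zeta>. D \<zeta> \<xi> \<eta>)" "\<And>\<zeta> \<eta>. linear (\<lambda>\<xi>. D \<zeta> \<xi> \<eta>)"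
    and D_commute: "\<And>\<zeta> \<xi> \<eta>. D \<zeta> \<xi> \<eta> = D \<zeta> \<eta> \<xi>"
  shows "\<exists>!\<Gamma>. bilinear \<Gamma> \<and> (\<forall>\<xi> \<eta>. \<Gamma> \<xi> \<eta> = \<Gamma> \<eta> \<xi>) \<and>
           (\<forall>\<zeta> \<xi> \<eta>. D \<zeta> \<xi> \<eta> = g (\<Gamma> \<zeta> \<xi>) \<eta> + g \<xi> (\<Gamma> \<zeta> \<eta>))"
proof -
  note g_lin = bilinear_ladd[OF g] bilinear_lmul[OF g] bilinear_lsub[OF g]
  have nondegenerate: "v = w" if "\<And>\<eta>. g v \<eta> = g w \<eta>" for v w
    using g_pos[of "v - w"] that[of "v - w"] by (fastforce simp: g_lin)
  have D3: "linear (\<lambda>\<eta>. D \<zeta> \<xi> \<eta>)" for \<zeta> \<xi>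
    using D(2)[of \<zeta> \<xi>] by (subst D_commute)
  define B where "B v = adjoint (g v) 1" for v
  have B: "\<eta> \<bullet> B v = g v \<eta>" for v \<eta>
    using adjoint_works[of "g v" \<eta> 1] g by (simp add: B_def bilinear_def)
  have B_lin: "linear B"
    by (rule linearI; rule vector_eq_ldot[THEN iffD1]) (simp_all add: B g_lin inner_add_right)
  have "inj B"
    unfolding linear_injective_0[OF B_lin] by (metis B g_pos inner_zero_right less_irrefl)
  then have "surj B" using linear_injective_imp_surjective[OF B_lin] by simp
  have riesz: "\<exists>v. \<forall>\<eta>. g v \<eta> = l \<eta>" if l: "linear l" for l
  proof -
    obtain v where "B v = adjoint l 1" using \<open>surj B\<close> by (metis surjD)
    then have "g v \<eta> = l \<eta>" for \<eta>
      using adjoint_works[OF l, of \<eta> 1] B[of \<eta> v] by simp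
    then show ?thesis by blast
  qed
  define \<kappa> where "\<kappa> \<zeta> \<xi> \<eta> = (1/2) * (D \<zeta> \<xi> \<eta> + D \<xi> \<zeta> \<eta> - D \<eta> \<zeta> \<xi>)" for \<zeta> \<xi> \<eta>
  note D_lin = linear_add[OF D(1)] linear_add[OF D(2)] linear_add[OF D3]
    linear_cmul[OF D(1)] linear_cmul[OF D(2)] linear_cmul[OF D3]
  have \<kappa>_lin: "linear (\<kappa> \<zeta> \<xi>)" for \<zeta> \<xi>
    by (rule linearI) (simp_all add: \<kappa>_def D_lin algebra_simps)
  define \<Gamma> where "\<Gamma> \<zeta> \<xi> = (SOME v. \<forall>\<eta>. g v \<eta> = \<kappa> \<zeta> \<xi> \<eta>)" for \<zeta> \<xi>
  have \<Gamma>: "g (\<Gamma> \<zeta> \<xi>) \<eta> = \<kappa> \<zeta> \<xi> \<eta>" for \<zeta> \<xi> \<eta>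
    using someI_ex[OF riesz[OF \<kappa>_lin]] unfolding \<Gamma>_def by blast
  show ?thesis
  proof (rule ex1I[of _ \<Gamma>], intro conjI allI)
    show "bilinear \<Gamma>"
      unfolding bilinear_def
      by (intro conjI allI; rule linearI; rule nondegenerate)
         (simp_all add: g_lin \<Gamma>, simp_all add: \<kappa>_def D_lin algebra_simps)
    show "\<Gamma> \<xi> \<eta> = \<Gamma> \<eta> \<xi>" for \<xi> \<eta>
      by (rule nondegenerate) (simp add: \<Gamma> \<kappa>_def D_commute)
    show "D \<zeta> \<xi> \<eta> = g (\<Gamma> \<zeta> \<xi>) \<eta> + g \<xi> (\<Gamma> \<zeta> \<eta>)" for \<zeta> \<xi> \<eta>
      unfolding g_commute[of \<xi>] \<Gamma> \<kappa>_def
      using D_commute[of \<zeta> \<xi> \<eta>] D_commute[of \<xi> \<zeta> \<eta>] D_commute[of \<eta> \<zeta> \<xi>] by (simp add: field_simps)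
  next
    fix \<Gamma>' assume "bilinear \<Gamma>' \<and> (\<forall>\<xi> \<eta>. \<Gamma>' \<xi> \<eta> = \<Gamma>' \<eta> \<xi>) \<and>
           (\<forall>\<zeta> \<xi> \<eta>. D \<zeta> \<xi> \<eta> = g (\<Gamma>' \<zeta> \<xi>) \<eta> + g \<xi> (\<Gamma>' \<zeta> \<eta>))"
    then have sym: "\<And>\<xi> \<eta>. \<Gamma>' \<xi> \<eta> = \<Gamma>' \<eta> \<xi>"
      and compat: "\<And>\<zeta> \<xi> \<eta>. D \<zeta> \<xi> \<eta> = g (\<Gamma>' \<zeta> \<xi>) \<eta> + g \<xi> (\<Gamma>' \<zeta> \<eta>)"
      by auto
    have "g (\<Gamma>' \<zeta> \<xi>) \<eta> = \<kappa> \<zeta> \<xi> \<eta>" for \<zeta> \<xi> \<eta>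
      unfolding \<kappa>_def compat
      using sym[of \<zeta> \<xi>] sym[of \<zeta> \<eta>] sym[of \<xi> \<eta>] g_commute[of \<xi>] g_commute[of \<zeta>]
      by (simp add: field_simps)
    then show "\<Gamma>' = \<Gamma>"
      by (intro ext nondegenerate) (simp add: \<Gamma>)
  qed
qed

lemma differentiable_matrix_mult:
  fixes F :: "'a::real_normed_vector \<Rightarrow> real^'b^'c" and G :: "'a \<Rightarrow> real^'d^'b"
  assumes "F differentiable (at x)" "G differentiable (at x)"
  shows "(\<lambda>x. F x ** G x) differentiable (at x)"
  using assms unfolding differentiable_def by (blast intro: has_derivative_matrix_mult)

lemma gmetric_differentiable:
  assumes Y: "invertible (transpose Y ** (Y :: real^'p^'n))"
  shows "(\<lambda>Z. gmetric Z \<xi> \<eta>) differentiable (at Y)"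
proof -
  have t: "transpose differentiable (at Y)"
    by (rule bounded_linear_imp_differentiable[OF bounded_linear_transpose])
  have gram: "(\<lambda>Z. transpose Z ** Z) differentiable (at Y)"
    by (rule differentiable_matrix_mult[OF t differentiable_ident])
  have inv: "matrix_inv differentiable (at (transpose Y ** Y))"
    using has_derivative_matrix_inv[OF Y] by (rule differentiableI)
  have K: "(\<lambda>Z. matrix_inv (transpose Z ** Z)) differentiable (at Y)"
    using differentiable_chain_at[OF gram inv] by (simp add: o_def)
  show ?thesis
    unfolding gmetric_eq_inner
    by (intro differentiable_inner differentiable_matrix_mult differentiable_diff
          differentiable_scaleR differentiable_const differentiable_ident t K)
qed

lemma eventually_invertible_gram:
  assumes Y: "invertible (transpose Y ** (Y :: real^'p^'n))"
  shows "eventually (\<lambda>Z. invertible (transpose Z ** (Z :: real^'p^'n))) (nhds Y)"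
proof -
  have "((\<lambda>Z. transpose Z ** Z) \<longlongrightarrow> transpose Y ** Y) (nhds Y)"
    by (intro bounded_bilinear.tendsto[OF bounded_bilinear_matrix_mult]
          bounded_linear.tendsto[OF bounded_linear_transpose] filterlim_ident)
  from eventually_compose_filterlim[OF eventually_invertible[OF Y] this] show ?thesis
    by eventually_elim (rule invertible_near(1)[OF Y])
qed

text \<open>The Christoffel form of the metric exists, so it can be used through its defining properties.
  What the Hessian at a critical point needs is that it vanishes on a zero argument.\<close>
lemma bilinear_levi_civita_christoffel:
  assumes Y: "invertible (transpose Y ** (Y :: real^'p^'n))"
  shows "bilinear (levi_civita_christoffel Y)"
proof -
  define D where "D \<zeta> \<xi> \<eta> = frechet_derivative (\<lambda>Z. gmetric Z \<xi> \<eta>) (at Y) \<zeta>" for \<zeta> \<xi> \<eta>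
  have D: "((\<lambda>Z. gmetric Z \<xi> \<eta>) has_derivative (\<lambda>\<zeta>. D \<zeta> \<xi> \<eta>)) (at Y)" for \<xi> \<eta>
    using gmetric_differentiable[OF Y, of \<xi> \<eta>] unfolding D_def frechet_derivative_works by simp
  have D_commute: "D \<zeta> \<xi> \<eta> = D \<zeta> \<eta> \<xi>" for \<zeta> \<xi> \<eta>
  proof -
    \<comment> \<open>The metric is known to be symmetric at full-rank matrices only, which form a neighbourhood.\<close>
    have "eventually (\<lambda>Z. gmetric Z \<xi> \<eta> = gmetric Z \<eta> \<xi>) (at Y)"
      using eventually_nhds_conv_at[THEN iffD1, OF eventually_invertible_gram[OF Y], THEN conjunct1]
      by eventually_elim (rule gmetric_commute)
    from has_derivative_transform_eventually[OF D this]
    have "((\<lambda>Z. gmetric Z \<eta> \<xi>) has_derivative (\<lambda>\<zeta>. D \<zeta> \<xi> \<eta>)) (at Y)"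
      by (simp add: gmetric_commute[OF Y])
    from has_derivative_unique[OF this D] show ?thesis by metis
  qed
  have D_add: "D \<zeta> (\<xi> + \<xi>') \<eta> = D \<zeta> \<xi> \<eta> + D \<zeta> \<xi>' \<eta>" for \<zeta> \<xi> \<xi>' \<eta>
    using has_derivative_unique[OF D[of "\<xi> + \<xi>'" \<eta>]
      has_derivative_add[OF D[of \<xi> \<eta>] D[of \<xi>' \<eta>], folded gmetric_add_left]] by metis
  have D_scale: "D \<zeta> (c *\<^sub>R \<xi>) \<eta> = c * D \<zeta> \<xi> \<eta>" for \<zeta> c \<xi> \<eta>
    using has_derivative_unique[OF D[of "c *\<^sub>R \<xi>" \<eta>]
      has_derivative_mult_right[OF D[of \<xi> \<eta>], of c, folded gmetric_scaleR_left]] by metis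
  have D_linear: "linear (\<lambda>\<xi>. D \<zeta> \<xi> \<eta>)" for \<zeta> \<eta>
    by (rule linearI) (simp_all add: D_add D_scale)
  have "bilinear (gmetric Y)"
    unfolding bilinear_def by (auto intro!: linearI simp: gmetric_distribs)
  then have "\<exists>!\<Gamma>. bilinear \<Gamma> \<and> (\<forall>\<xi> \<eta>. \<Gamma> \<xi> \<eta> = \<Gamma> \<eta> \<xi>) \<and>
           (\<forall>\<zeta> \<xi> \<eta>. D \<zeta> \<xi> \<eta> = gmetric Y (\<Gamma> \<zeta> \<xi>) \<eta> + gmetric Y \<xi> (\<Gamma> \<zeta> \<eta>))"
    by (rule ex1_christoffel)
       (auto intro: gmetric_commute[OF Y] gmetric_pos[OF Y] has_derivative_linear[OF D] D_commute D_linear)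
  from theI'[OF this] show ?thesis
    unfolding levi_civita_christoffel_def D_def by blast
qed

lemma layer_op_eq:
  "layer_op f X V = (ehess f X V ** transpose X + egrad f X ** transpose V
     - transpose (ehess f X V ** transpose X + egrad f X ** transpose V)) ** X"
  by (simp add: layer_op_def two_skew flip: bounded_bilinear.scaleR_left[OF bounded_bilinear_matrix_mult])

lemma has_derivative_ehess:
  assumes "egrad f differentiable (at X)"
  shows "(egrad f has_derivative ehess f X) (at X)"
  using assms unfolding ehess_def frechet_derivative_works .

text \<open>At a critical point the gradient field vanishes, so the connection reduces to the plain derivative.
  Differentiating \<open>2 skew(\<nabla>f(Z) Z\<^sup>T) Z\<close> leaves only the terms in which the skew factor is
  differentiated, and these form \<^const>\<open>layer_op\<close>, whose values are already tangent.\<close>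
lemma rhess_eq_layer_op_at_critical_point:
  fixes f :: "real^'p^'n \<Rightarrow> real"
  assumes X: "invertible (transpose X ** X)"
    and f: "eventually (\<lambda>Z. f differentiable (at Z)) (nhds X)"
    and f': "egrad f differentiable (at X)"
    and critical: "skew (egrad f X ** transpose X) = 0"
  shows "rhess f X \<xi> = layer_op f X \<xi>"
proof -
  let ?S = "\<lambda>Z. egrad f Z ** transpose Z"
  have rgrad: "eventually (\<lambda>Z. (?S Z - transpose (?S Z)) ** Z = rgrad f Z) (nhds X)"
    using f eventually_invertible_gram[OF X]
    by eventually_elim (simp only: rgrad_eq two_skew)
  then have rgrad_X: "rgrad f X = 0"
    using rgrad_eq[OF X eventually_nhds_x_imp_x[OF f]] critical by (simp add: matrix_mult_zeros)
  have S0: "?S X - transpose (?S X) = 0"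
    using critical by (simp flip: two_skew)
  have dS: "(?S has_derivative (\<lambda>h. egrad f X ** transpose h + ehess f X h ** transpose X)) (at X)"
    by (rule has_derivative_matrix_mult[OF has_derivative_ehess[OF f']
          has_derivative_transpose[OF has_derivative_ident]])
  have "((\<lambda>Z. (?S Z - transpose (?S Z)) ** Z) has_derivative layer_op f X) (at X)"
    by (rule has_derivative_eq_rhs[OF has_derivative_matrix_mult[OF
          has_derivative_diff[OF dS has_derivative_transpose[OF dS]] has_derivative_ident]])
       (simp add: S0 matrix_mult_zeros layer_op_eq add.commute fun_eq_iff)
  then have "(rgrad f has_derivative layer_op f X) (at X)"
    by (rule has_derivative_transform_eventually)
       (use rgrad in \<open>auto simp: eventually_nhds_conv_at\<close>)
  then have "frechet_derivative (rgrad f) (at X) = layer_op f X"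
    by (rule frechet_derivative_at[symmetric])
  then have "levi_civita (rgrad f) X \<xi> = layer_op f X \<xi>"
    by (simp add: levi_civita_def rgrad_X bilinear_rzero[OF bilinear_levi_civita_christoffel[OF X]])
  moreover have "layer_op f X \<xi> \<in> layer_tangent X"
    unfolding layer_op_eq by (rule skew_mult_in_layer_tangent)
  ultimately show ?thesis
    by (simp add: rhess_def tangent_proj_eq_self[OF X])
qed

section \<open>Superlinear convergence of a contracting sequence\<close>

text \<open>Close to the limit, \<open>C d powr q = (C d powr (q - 1)) d\<close> is at most \<open>d / 2\<close>.  The radius is chosen so,
  and then the iterates stay in the ball where the error estimate holds and the errors are halved.\<close>
lemma superlinear_convergence:
  fixes L :: "'a::real_normed_vector"
  assumes q: "q > 1" and C: "C \<ge> 0" and r: "r > 0"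
  shows "\<exists>\<delta>>0. \<delta> \<le> r \<and> (\<forall>x. x 0 \<in> ball L \<delta> \<longrightarrow>
           (\<forall>k. x k \<in> ball L r \<longrightarrow> norm (x (Suc k) - L) \<le> C * norm (x k - L) powr q) \<longrightarrow>
           (\<forall>k. x k \<in> ball L r) \<and> converges_with_order q x L)"
proof -
  define s where "s = 1 / (2 * (C + 1))"
  have s: "0 < s" "C * s \<le> 1/2" using C by (simp_all add: s_def field_simps)
  define \<delta> where "\<delta> = min r (s powr (1 / (q - 1)))"
  have contraction: "C * d powr q \<le> 1/2 * d" if d: "0 \<le> d" "d < \<delta>" for d
  proof -
    have "d powr (q - 1) \<le> (s powr (1 / (q - 1))) powr (q - 1)"
      using d q by (intro powr_mono2) (auto simp: \<delta>_def)
    also have "\<dots> = s" using q s by (simp add: powr_powr)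
    finally have "C * d powr (q - 1) \<le> 1/2"
      using mult_left_mono[of "d powr (q - 1)" s C] C s by linarith
    then have "C * d powr (q - 1) * d \<le> 1/2 * d" using d by (intro mult_right_mono)
    also have "C * d powr (q - 1) * d = C * d powr q"
      using powr_add[of d "q - 1" 1] d by (simp add: powr_one)
    finally show ?thesis .
  qed
  have "(\<forall>k. x k \<in> ball L r) \<and> converges_with_order q x L"
    if x0: "x 0 \<in> ball L \<delta>"
      and step: "\<And>k. x k \<in> ball L r \<Longrightarrow> norm (x (Suc k) - L) \<le> C * norm (x k - L) powr q" for x
  proof -
    have decay: "x k \<in> ball L \<delta> \<and> norm (x k - L) \<le> (1/2) ^ k * norm (x 0 - L)" for k
    proof (induction k)
      case 0
      then show ?case using x0 by simp
    next
      case (Suc k)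
      then have "norm (x k - L) < \<delta>" by (simp add: dist_norm norm_minus_commute)
      moreover from this have "norm (x (Suc k) - L) \<le> C * norm (x k - L) powr q"
        by (intro step) (simp add: \<delta>_def dist_norm norm_minus_commute)
      ultimately have half: "norm (x (Suc k) - L) \<le> 1/2 * norm (x k - L)"
        using contraction[of "norm (x k - L)"] by simp
      also have "\<dots> \<le> 1/2 * ((1/2) ^ k * norm (x 0 - L))"
        using Suc by (intro mult_left_mono) auto
      finally have "norm (x (Suc k) - L) \<le> (1/2) ^ Suc k * norm (x 0 - L)" by simp
      moreover have "norm (x (Suc k) - L) < \<delta>"
        using half \<open>norm (x k - L) < \<delta>\<close> norm_ge_zero[of "x k - L"] by linarith
      ultimately show ?case by (simp add: dist_norm norm_minus_commute)
    qed
    then have in_ball: "x k \<in> ball L r" for k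
      using decay[of k] by (auto simp: \<delta>_def)
    have "(\<lambda>k. (1/2) ^ k * norm (x 0 - L)) \<longlonglongrightarrow> 0 * norm (x 0 - L)"
      by (intro tendsto_intros LIMSEQ_power_zero) simp
    then have "(\<lambda>k. x k - L) \<longlonglongrightarrow> 0"
      by (intro Lim_null_comparison[of "\<lambda>k. x k - L" "\<lambda>k. (1/2) ^ k * norm (x 0 - L)"])
         (use decay in \<open>auto\<close>)
    then have "x \<longlonglongrightarrow> L" by (simp add: LIM_zero_iff)
    then show ?thesis
      using in_ball step by (auto simp: converges_with_order_def)
  qed
  moreover have "\<delta> > 0" "\<delta> \<le> r" using r s by (simp_all add: \<delta>_def)
  ultimately show ?thesis by blast
qed

section \<open>Local estimates for the Newton step\<close>

lemma norm_matrix_mult_bound: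
  fixes A :: "real^'b^'a" and B :: "real^'c^'b"
  assumes "norm A \<le> a" "norm B \<le> b"
  shows "norm (A ** B) \<le> a * b"
  using norm_matrix_mult_le[of A B] mult_mono[OF assms] assms
  by (meson norm_ge_zero order_trans)

lemma norm_skew_part_bound:
  fixes A :: "real^'n^'n"
  assumes "norm A \<le> a"
  shows "norm (A - transpose A) \<le> 2 * a"
  using norm_triangle_ineq4[of A "transpose A"] norm_transpose[of A] assms by linarith

text \<open>The normal step is a Newton step for the constraint \<open>X\<^sup>T X = I\<close>: it cancels the defect \<open>G\<close> to first
  order.\<close>
lemma normal_step_in_gram:
  fixes X :: "real^'p^'n"
  defines "N \<equiv> normal_step X" and "G \<equiv> transpose X ** X - mat 1"
  shows "transpose N ** X + transpose X ** N = - (G + G ** G)"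
proof -
  have XX: "transpose X ** X = mat 1 + G" by (simp add: G_def)
  have tG: "transpose G = G" by (simp add: G_def transpose_distribs)
  have N: "N = - (1/2) *\<^sub>R (X ** G)" by (simp add: N_def normal_step_def G_def)
  have "transpose N ** X = - (1/2) *\<^sub>R (G ** (transpose X ** X))"
    by (simp add: N transpose_distribs tG matrix_mult_distribs matrix_mul_assoc)
  moreover have "transpose X ** N = - (1/2) *\<^sub>R ((transpose X ** X) ** G)"
    by (simp add: N matrix_mult_distribs matrix_mul_assoc)
  ultimately have "transpose N ** X + transpose X ** N = - (1/2) *\<^sub>R ((G + G ** G) + (G + G ** G))"
    unfolding XX by (simp add: matrix_mult_distribs scaleR_add_right)
  then show ?thesis by (simp only: scaleR_minus_left scaleR_half_double)
qed

text \<open>The quantitative input of the local analysis.  One constant \<open>M \<ge> 1\<close> serves as bound and as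
  Lipschitz constant of everything, so that products of bounds are just powers of \<open>M\<close>; a radius
  \<open>r \<le> 1\<close> lets higher powers of the error be absorbed by lower ones.\<close>
locale critical_point_bounds =
  fixes f :: "real^'p^'n \<Rightarrow> real" and Xs :: "real^'p^'n" and M r :: real
  assumes gram: "transpose Xs ** Xs = mat 1"
    and critical: "skew (egrad f Xs ** transpose Xs) = 0"
    and M: "1 \<le> M" and r: "0 < r" "r \<le> 1"
    and rgrad: "X \<in> ball Xs r \<Longrightarrow> rgrad f X = 2 *\<^sub>R skew (egrad f X ** transpose X) ** X"
    and ehess_linear: "X \<in> ball Xs r \<Longrightarrow> linear (ehess f X)"
    and norm_le: "X \<in> ball Xs r \<Longrightarrow> norm X \<le> M"
    and norm_egrad: "norm (egrad f Xs) \<le> M" "X \<in> ball Xs r \<Longrightarrow> norm (egrad f X) \<le> M"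
    and egrad_diff: "X \<in> ball Xs r \<Longrightarrow> norm (egrad f X - egrad f Xs) \<le> M * norm (X - Xs)"
    and norm_ehess: "X \<in> ball Xs r \<Longrightarrow> norm (ehess f X V) \<le> M * norm V"
    and ehess_diff: "X \<in> ball Xs r \<Longrightarrow> norm (ehess f X V - ehess f Xs V) \<le> M * norm (X - Xs) * norm V"
    and egrad_remainder: "X \<in> ball Xs r \<Longrightarrow>
           norm (egrad f Xs - egrad f X + ehess f X (X - Xs)) \<le> M * (norm (X - Xs))\<^sup>2"
begin

lemma center: "Xs \<in> ball Xs r" using r by simp

lemma layer_op_add:
  assumes "X \<in> ball Xs r"
  shows "layer_op f X (V + W) = layer_op f X V + layer_op f X W"
  by (simp add: layer_op_eq linear_add[OF ehess_linear[OF assms]] matrix_mult_distribs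
        transpose_distribs algebra_simps)

lemma layer_op_linear:
  assumes "X \<in> ball Xs r"
  shows "linear (layer_op f X)"
proof (rule linearI)
  show "layer_op f X (c *\<^sub>R V) = c *\<^sub>R layer_op f X V" for c V
    by (simp add: layer_op_eq linear_cmul[OF ehess_linear[OF assms]] matrix_mult_distribs
        transpose_distribs scaleR_diff_right scaleR_add_right)
qed (rule layer_op_add[OF assms])

lemma norm_layer_op_le:
  assumes X: "X \<in> ball Xs r"
  shows "norm (layer_op f X V) \<le> 4 * M ^ 3 * norm V"
proof -
  have "norm (ehess f X V ** transpose X + egrad f X ** transpose V) \<le> (M * norm V) * M + M * norm V"
    using X by (intro norm_triangle_mono norm_matrix_mult_bound) (simp_all add: norm_transpose norm_ehess norm_le norm_egrad)
  also have "\<dots> \<le> 2 * M\<^sup>2 * norm V"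
    using mult_right_mono[OF power_increasing[of 1 2 M], of "norm V"] M
    by (simp add: power2_eq_square algebra_simps)
  finally have "norm (layer_op f X V) \<le> (2 * (2 * M\<^sup>2 * norm V)) * M"
    unfolding layer_op_eq by (intro norm_matrix_mult_bound norm_skew_part_bound norm_le X)
  then show ?thesis by (simp add: power2_eq_square power3_eq_cube mult_ac)
qed

text \<open>The operator is a polynomial expression in \<open>X\<close>, \<open>\<nabla>f(X)\<close> and \<open>\<nabla>\<^sup>2f(X)\<close>, all of which are Lipschitz
  at \<open>Xs\<close>.\<close>
lemma layer_op_diff_le:
  assumes X: "X \<in> ball Xs r"
  shows "norm (layer_op f X V - layer_op f Xs V) \<le> 10 * M ^ 3 * norm (X - Xs) * norm V"
proof -
  let ?d = "norm (X - Xs)" and ?v = "norm V"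
  let ?Q = "\<lambda>X. ehess f X V ** transpose X + egrad f X ** transpose V"
  let ?m = "?d * ?v"
  have pw: "M * ?m \<le> M\<^sup>2 * ?m" "M\<^sup>2 * ?m \<le> M ^ 3 * ?m"
    using M power_increasing[of 1 2 M] power_increasing[of 2 3 M] by (auto intro: mult_right_mono)
  have "?Q X - ?Q Xs = (ehess f X V - ehess f Xs V) ** transpose X
      + ehess f Xs V ** transpose (X - Xs) + (egrad f X - egrad f Xs) ** transpose V"
    by (simp add: matrix_mult_distribs transpose_distribs algebra_simps)
  also have "norm \<dots> \<le> (M * ?d * ?v) * M + (M * ?v) * ?d + (M * ?d) * ?v"
    using X center
    by (intro norm_triangle_mono norm_matrix_mult_bound)
       (simp_all add: norm_transpose norm_ehess norm_le ehess_diff egrad_diff)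
  also have "\<dots> \<le> 3 * (M\<^sup>2 * ?m)"
    using pw by (simp add: power2_eq_square mult_ac)
  finally have Q_diff: "norm (?Q X - ?Q Xs) \<le> 3 * (M\<^sup>2 * ?m)" .
  have "norm (?Q Xs) \<le> (M * ?v) * M + M * ?v"
    using center
    by (intro norm_triangle_mono norm_matrix_mult_bound) (simp_all add: norm_transpose norm_ehess norm_le norm_egrad)
  also have "\<dots> \<le> 2 * M\<^sup>2 * ?v"
    using mult_right_mono[OF power_increasing[of 1 2 M], of ?v] M
    by (simp add: power2_eq_square algebra_simps)
  finally have Q: "norm (?Q Xs) \<le> 2 * M\<^sup>2 * ?v" .
  have "layer_op f X V - layer_op f Xs V
      = ((?Q X - ?Q Xs) - transpose (?Q X - ?Q Xs)) ** X + (?Q Xs - transpose (?Q Xs)) ** (X - Xs)"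
    unfolding layer_op_eq transpose_diff matrix_mult_distribs(3,4) by simp
  also have "norm \<dots> \<le> (2 * (3 * (M\<^sup>2 * ?m))) * M + (2 * (2 * M\<^sup>2 * ?v)) * ?d"
    by (intro norm_triangle_mono norm_matrix_mult_bound norm_skew_part_bound Q Q_diff norm_le X order_refl)
  also have "\<dots> = 6 * (M ^ 3 * ?m) + 4 * (M\<^sup>2 * ?m)"
    by (simp add: power2_eq_square power3_eq_cube mult_ac)
  also have "\<dots> \<le> 10 * M ^ 3 * ?d * ?v"
    using pw(2) by (simp add: mult_ac)
  finally show ?thesis .
qed

text \<open>Taylor expansion of the gradient field about \<open>X\<close>, evaluated at the critical point.  With
  \<open>E = X - Xs\<close>, the skew parts of \<open>\<nabla>f(X) X\<^sup>T\<close> and \<open>\<nabla>\<^sup>2f(X)[E] X\<^sup>T + \<nabla>f(X) E\<^sup>T\<close> differ by the skew part of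
  \<open>\<nabla>f(Xs) Xs\<^sup>T\<close>, which is zero, and of \<open>?Z\<close>, in which every term is quadratic in \<open>E\<close>.\<close>
lemma rgrad_expansion:
  assumes X: "X \<in> ball Xs r"
  shows "norm (rgrad f X - layer_op f X (X - Xs)) \<le> 4 * M ^ 3 * (norm (X - Xs))\<^sup>2"
proof -
  let ?d = "norm (X - Xs)"
  let ?H = "ehess f X (X - Xs)"
  let ?R = "egrad f Xs - egrad f X + ?H"
  let ?Z = "?R ** transpose Xs + ?H ** transpose (X - Xs)"
  have c: "egrad f Xs ** transpose Xs = transpose (egrad f Xs ** transpose Xs)"
    using critical two_skew[of "egrad f Xs ** transpose Xs"] by simp
  have skew_diff: "(A - transpose A) ** X - (B - transpose B) ** X
      = ((A - B) - transpose (A - B)) ** X" for A B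
    by (simp add: transpose_diff matrix_mult_distribs)
  have sym_cancel: "(A - B) - transpose (A - B) = - (B - transpose B)"
    if "A = transpose A" for A B :: "real^'n^'n"
    using that by (simp add: transpose_diff)
  have "egrad f X ** transpose X - (?H ** transpose X + egrad f X ** transpose (X - Xs))
      = egrad f Xs ** transpose Xs - ?Z"
    by (simp add: matrix_mult_distribs transpose_distribs algebra_simps)
  then have "rgrad f X - layer_op f X (X - Xs)
      = ((egrad f Xs ** transpose Xs - ?Z) - transpose (egrad f Xs ** transpose Xs - ?Z)) ** X"
    unfolding rgrad[OF X] layer_op_eq two_skew skew_diff by (simp only:)
  also have "\<dots> = - ((?Z - transpose ?Z) ** X)"
    unfolding sym_cancel[OF c] by (simp only: matrix_mult_distribs(5))
  finally have eq: "rgrad f X - layer_op f X (X - Xs) = - ((?Z - transpose ?Z) ** X)" .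
  have "norm ?Z \<le> (M * ?d\<^sup>2) * M + (M * ?d) * ?d"
    using X center by (intro norm_triangle_mono norm_matrix_mult_bound)
       (simp_all add: norm_transpose norm_ehess norm_le egrad_remainder)
  also have "\<dots> \<le> 2 * M\<^sup>2 * ?d\<^sup>2"
    using mult_right_mono[OF power_increasing[of 1 2 M], of "?d\<^sup>2"] M
    by (simp add: power2_eq_square algebra_simps)
  finally have "norm ((?Z - transpose ?Z) ** X) \<le> (2 * (2 * M\<^sup>2 * ?d\<^sup>2)) * M"
    by (intro norm_matrix_mult_bound norm_skew_part_bound norm_le X)
  then show ?thesis unfolding eq by (simp add: power2_eq_square power3_eq_cube mult_ac)
qed

lemma gram_defect_le:
  assumes X: "X \<in> ball Xs r"
  shows "norm (transpose X ** X - mat 1) \<le> 2 * M * norm (X - Xs)"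
proof -
  have "transpose X ** X - mat 1 = transpose X ** (X - Xs) + transpose (X - Xs) ** Xs"
    by (simp add: matrix_mult_distribs transpose_distribs gram)
  also have "norm \<dots> \<le> M * norm (X - Xs) + norm (X - Xs) * M"
    using X center by (intro norm_triangle_mono norm_matrix_mult_bound) (simp_all add: norm_transpose norm_le)
  finally show ?thesis by simp
qed

lemma norm_newton_rhs_le:
  assumes X: "X \<in> ball Xs r"
  shows "norm (newton_rhs f X) \<le> 12 * M ^ 5 * norm (X - Xs)"
proof -
  let ?d = "norm (X - Xs)"
  have d1: "?d \<le> 1" using X r by (simp add: dist_norm norm_minus_commute)
  have pw: "M ^ 3 * ?d \<le> M ^ 5 * ?d"
    using M power_increasing[of 3 5 M] by (intro mult_right_mono) auto
  have "norm (normal_step X) = (1/2) * norm (X ** (transpose X ** X - mat 1))"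
    by (simp add: normal_step_def)
  also have "\<dots> \<le> (1/2) * (M * (2 * M * ?d))"
    using norm_matrix_mult_bound[OF norm_le[OF X] gram_defect_le[OF X]] by simp
  finally have N: "norm (normal_step X) \<le> M\<^sup>2 * ?d" by (simp add: power2_eq_square)
  have "newton_rhs f X = - (rgrad f X - layer_op f X (X - Xs)) - layer_op f X (X - Xs)
      - layer_op f X (normal_step X)"
    by (simp add: newton_rhs_def)
  also have "norm \<dots> \<le> 4 * M ^ 3 * ?d\<^sup>2 + 4 * M ^ 3 * ?d + 4 * M ^ 3 * norm (normal_step X)"
    using rgrad_expansion[OF X] norm_layer_op_le[OF X]
    by (intro order_trans[OF norm_triangle_ineq4] add_mono) (simp_all only: norm_minus_cancel)
  also have "\<dots> \<le> 4 * M ^ 3 * ?d + 4 * M ^ 3 * ?d + 4 * M ^ 3 * (M\<^sup>2 * ?d)"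
  proof -
    have "?d\<^sup>2 \<le> ?d" using d1 by (simp add: power2_eq_square mult_left_le)
    then show ?thesis using M N by (intro add_mono mult_left_mono) auto
  qed
  also have "\<dots> = 8 * (M ^ 3 * ?d) + 4 * (M ^ 5 * ?d)"
    by (simp add: power2_eq_square power3_eq_cube eval_nat_numeral)
  also have "\<dots> \<le> 12 * M ^ 5 * ?d" using pw by (simp add: algebra_simps)
  finally show ?thesis .
qed

text \<open>Applied to the new error, the operator gives its value at the old error, minus the gradient, plus
  the residual: the linear system solved by \<open>T\<close> accounts for the contribution of the normal step.\<close>
lemma newton_error_layer_op:
  assumes X: "X \<in> ball Xs r"
  shows "norm (layer_op f X (X + (T + normal_step X) - Xs))
      \<le> 4 * M ^ 3 * (norm (X - Xs))\<^sup>2 + norm (newton_residual f X T)"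
proof -
  have "layer_op f X (X + (T + normal_step X) - Xs)
      = layer_op f X ((X - Xs) + (T + normal_step X))"
    by (simp add: algebra_simps)
  also have "\<dots> = - (rgrad f X - layer_op f X (X - Xs)) + newton_residual f X T"
    by (simp only: layer_op_add[OF X] newton_residual_def newton_rhs_def) simp
  finally have eq: "layer_op f X (X + (T + normal_step X) - Xs)
      = - (rgrad f X - layer_op f X (X - Xs)) + newton_residual f X T" .
  show ?thesis
    unfolding eq using norm_triangle_ineq[of "- (rgrad f X - layer_op f X (X - Xs))" "newton_residual f X T"]
      rgrad_expansion[OF X] norm_minus_cancel[of "rgrad f X - layer_op f X (X - Xs)"] by linarith
qed

text \<open>The same for the constraint.  The tangential step does not change the Gram matrix to first order,
  the normal step contributes \<open>- (G + G\<^sup>2)\<close>, and the old error contributes \<open>G\<close> up to a quadratic term.\<close>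
lemma newton_error_gram:
  assumes X: "X \<in> ball Xs r" and T: "T \<in> layer_tangent X"
  defines "E \<equiv> X + (T + normal_step X) - Xs"
  shows "norm (transpose E ** X + transpose X ** E) \<le> 5 * M\<^sup>2 * (norm (X - Xs))\<^sup>2"
proof -
  let ?d = "norm (X - Xs)"
  define G where "G = transpose X ** X - mat 1"
  have G_le: "norm G \<le> 2 * M * ?d"
    unfolding G_def by (rule gram_defect_le[OF X])
  have tangential: "transpose T ** X + transpose X ** T = 0"
    using T by (simp add: layer_tangent_def)
  have normal: "transpose (normal_step X) ** X + transpose X ** normal_step X = - (G + G ** G)"
    unfolding G_def by (rule normal_step_in_gram)
  have "transpose (X - Xs) ** X + transpose X ** (X - Xs) - G = transpose (X - Xs) ** (X - Xs)"
    by (simp add: G_def matrix_mult_distribs transpose_distribs gram)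
  moreover have "E = (X - Xs) + T + normal_step X" by (simp add: E_def)
  then have "transpose E ** X + transpose X ** E
      = (transpose (X - Xs) ** X + transpose X ** (X - Xs)) + (transpose T ** X + transpose X ** T)
        + (transpose (normal_step X) ** X + transpose X ** normal_step X)"
    by (simp only: transpose_add matrix_mult_distribs(1,2)) (simp only: ac_simps)
  ultimately have "transpose E ** X + transpose X ** E = transpose (X - Xs) ** (X - Xs) - G ** G"
    unfolding tangential normal by (simp add: algebra_simps)
  also have "norm \<dots> \<le> ?d * ?d + (2 * M * ?d) * (2 * M * ?d)"
    by (rule order_trans[OF norm_triangle_ineq4])
       (intro add_mono norm_matrix_mult_bound G_le, simp_all add: norm_transpose)
  also have "\<dots> \<le> 5 * M\<^sup>2 * ?d\<^sup>2"
    using mult_right_mono[OF one_le_power[OF M, of 2], of "?d\<^sup>2"] by (simp add: power2_eq_square algebra_simps)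
  finally show ?thesis .
qed

text \<open>The tangent spaces vary with \<open>X\<close>, so injectivity on them does not carry over to nearby points
  directly.  Pairing the operator with the tangency defect \<open>V\<^sup>T X + X\<^sup>T V\<close> gives an injective linear map on
  the whole space, and a lower bound for it at \<open>Xs\<close> persists nearby.\<close>
lemma newton_operator_coercive:
  assumes inj: "\<And>\<xi>. \<xi> \<in> layer_tangent Xs \<Longrightarrow> layer_op f Xs \<xi> = 0 \<Longrightarrow> \<xi> = 0"
  obtains c \<rho> where "0 < c" "0 < \<rho>" "\<rho> \<le> r"
    "\<And>X V. X \<in> ball Xs \<rho> \<Longrightarrow>
       c * norm V \<le> norm (layer_op f X V) + norm (transpose V ** X + transpose X ** V)"
proof -
  let ?\<Phi> = "\<lambda>V. (layer_op f Xs V, transpose V ** Xs + transpose Xs ** V)"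
  note L = layer_op_linear[OF center]
  have lin: "linear ?\<Phi>"
    by (rule linearI)
       (simp_all add: linear_add[OF L] linear_cmul[OF L] matrix_mult_distribs transpose_distribs scaleR_add_right)
  moreover have "inj ?\<Phi>"
    unfolding linear_injective_0[OF lin]
    using inj by (auto simp: zero_prod_def layer_tangent_def)
  ultimately obtain b where b: "b > 0" "\<And>V. b * norm V \<le> norm (?\<Phi> V)"
    by (rule linear_inj_bounded_below_pos) blast
  \<comment> \<open>Moving from \<open>Xs\<close> to \<open>X\<close> changes the pair by at most \<open>(10 M\<^sup>3 + 2) \<parallel>X - Xs\<parallel> \<parallel>V\<parallel>\<close>; within
    this radius at least half of the lower bound \<open>b\<close> survives.\<close>
  define \<rho> where "\<rho> = min r (b / (2 * (10 * M ^ 3 + 2)))"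
  have pos: "10 * M ^ 3 + 2 > 0" using M by (simp add: add_pos_pos)
  have bound: "b / 2 * norm V \<le> norm (layer_op f X V) + norm (transpose V ** X + transpose X ** V)"
    if X: "X \<in> ball Xs \<rho>" for X V
  proof -
    let ?d = "norm (X - Xs)"
    have Xr: "X \<in> ball Xs r" using X by (simp add: \<rho>_def)
    have "?d * (10 * M ^ 3 + 2) \<le> b / 2"
      using X pos by (simp add: \<rho>_def dist_norm norm_minus_commute field_simps)
    then have small: "10 * M ^ 3 * ?d * norm V + 2 * ?d * norm V \<le> b / 2 * norm V"
      using mult_right_mono[of "?d * (10 * M ^ 3 + 2)" "b/2" "norm V"] by (simp add: algebra_simps)
    have "(transpose V ** X + transpose X ** V) - (transpose V ** Xs + transpose Xs ** V)
        = transpose V ** (X - Xs) + transpose (X - Xs) ** V"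
      by (simp add: matrix_mult_distribs transpose_distribs)
    also have "norm \<dots> \<le> norm V * ?d + ?d * norm V"
      by (intro norm_triangle_mono norm_matrix_mult_bound) (simp_all add: norm_transpose)
    finally have sym: "norm (transpose V ** Xs + transpose Xs ** V)
        \<le> norm (transpose V ** X + transpose X ** V) + 2 * ?d * norm V"
      using norm_triangle_sub[of "transpose V ** Xs + transpose Xs ** V" "transpose V ** X + transpose X ** V"]
      by (simp add: norm_minus_commute mult_ac)
    have op: "norm (layer_op f Xs V) \<le> norm (layer_op f X V) + 10 * M ^ 3 * ?d * norm V"
      using norm_triangle_sub[of "layer_op f Xs V" "layer_op f X V"] layer_op_diff_le[OF Xr, of V]
      by (simp add: norm_minus_commute)
    have "b * norm V \<le> norm (layer_op f Xs V) + norm (transpose V ** Xs + transpose Xs ** V)"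
      using b(2)[of V] norm_Pair_le[of "layer_op f Xs V" "transpose V ** Xs + transpose Xs ** V"] by linarith
    with op sym small show ?thesis by (simp add: field_simps)
  qed
  show ?thesis
  proof (rule that[OF _ _ _ bound])
    show "0 < b / 2" "0 < \<rho>" "\<rho> \<le> r" using b pos r by (simp_all add: \<rho>_def)
  qed
qed

end

context critical_point_bounds
begin

text \<open>Both components of the coercive pair, evaluated at the new error, are quadratic in the old error
  except for the residual, which is of order \<open>1 + \<theta>\<close> because the right-hand side is of first order.\<close>
lemma inexact_newton_step:
  assumes inj: "\<And>\<xi>. \<xi> \<in> layer_tangent Xs \<Longrightarrow> layer_op f Xs \<xi> = 0 \<Longrightarrow> \<xi> = 0"
    and \<theta>: "\<theta> > 0"
  obtains C \<rho> where "0 \<le> C" "0 < \<rho>" "\<rho> \<le> r"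
    "\<And>X T. X \<in> ball Xs \<rho> \<Longrightarrow> T \<in> layer_tangent X \<Longrightarrow>
       norm (newton_residual f X T) \<le> norm (newton_rhs f X) powr \<theta> * norm (newton_rhs f X) \<Longrightarrow>
       norm (X + (T + normal_step X) - Xs) \<le> C * norm (X - Xs) powr (min 2 (1 + \<theta>))"
proof -
  obtain c \<rho> where c: "0 < c" and \<rho>: "0 < \<rho>" "\<rho> \<le> r"
    and coercive: "\<And>X V. X \<in> ball Xs \<rho> \<Longrightarrow>
       c * norm V \<le> norm (layer_op f X V) + norm (transpose V ** X + transpose X ** V)"
    using newton_operator_coercive[OF inj] by blast
  define q where "q = min 2 (1 + \<theta>)"
  define K where "K = (12 * M ^ 5) powr (1 + \<theta>)"
  define C where "C = (4 * M ^ 3 + K + 5 * M\<^sup>2) / c"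
  have "norm (X + (T + normal_step X) - Xs) \<le> C * norm (X - Xs) powr q"
    if X\<rho>: "X \<in> ball Xs \<rho>" and T: "T \<in> layer_tangent X"
      and res: "norm (newton_residual f X T) \<le> norm (newton_rhs f X) powr \<theta> * norm (newton_rhs f X)"
    for X T
  proof -
    let ?d = "norm (X - Xs)" and ?b = "norm (newton_rhs f X)"
    define E where "E = X + (T + normal_step X) - Xs"
    have X: "X \<in> ball Xs r" using X\<rho> \<rho> by auto
    have d: "0 \<le> ?d" "?d \<le> 1" using X r by (simp_all add: dist_norm norm_minus_commute)
    have "?d\<^sup>2 = ?d powr 2" by (cases "?d = 0") simp_all
    also have "\<dots> \<le> ?d powr q" using d by (intro powr_mono') (auto simp: q_def)
    finally have d2: "?d\<^sup>2 \<le> ?d powr q" .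
    have "norm (newton_residual f X T) \<le> ?b powr (1 + \<theta>)"
      using res by (simp add: powr_add mult.commute)
    also have "\<dots> \<le> (12 * M ^ 5 * ?d) powr (1 + \<theta>)"
      using norm_newton_rhs_le[OF X] \<theta> by (intro powr_mono2) auto
    also have "\<dots> = K * ?d powr (1 + \<theta>)"
      unfolding K_def by (rule powr_mult)
    also have "\<dots> \<le> K * ?d powr q"
      using d by (intro mult_left_mono powr_mono') (auto simp: q_def K_def)
    finally have res': "norm (newton_residual f X T) \<le> K * ?d powr q" .
    have "c * norm E \<le> (4 * M ^ 3 * ?d\<^sup>2 + K * ?d powr q) + 5 * M\<^sup>2 * ?d\<^sup>2"
      using coercive[OF X\<rho>, of E] newton_error_layer_op[OF X, of T] newton_error_gram[OF X T] res'
      unfolding E_def by linarith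
    also have "\<dots> \<le> (4 * M ^ 3 * ?d powr q + K * ?d powr q) + 5 * M\<^sup>2 * ?d powr q"
      using M d2 by (intro add_mono mult_left_mono order_refl) auto
    also have "\<dots> = c * (C * ?d powr q)"
      using c by (simp add: C_def field_simps)
    finally show ?thesis using c by (simp add: E_def)
  qed
  moreover have "0 \<le> C" using M c by (simp add: C_def K_def)
  ultimately show ?thesis using that \<rho> by (simp add: q_def)
qed

end

section \<open>Convergence of the iteration\<close>

lemma eventually_stiefel_nbhd:
  assumes "Xs \<in> stiefel" "0 < \<epsilon>"
  shows "eventually (\<lambda>X. X \<in> stiefel_nbhd \<epsilon>) (nhds Xs)"
proof -
  have "((\<lambda>X. norm (transpose X ** X - mat 1)) \<longlongrightarrow> norm (transpose Xs ** Xs - mat 1)) (nhds Xs)"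
    by (intro tendsto_intros bounded_bilinear.tendsto[OF bounded_bilinear_matrix_mult]
          bounded_linear.tendsto[OF bounded_linear_transpose] filterlim_ident)
  then have "eventually (\<lambda>X. norm (transpose X ** X - mat 1) < \<epsilon>) (nhds Xs)"
    by (rule order_tendstoD) (use assms in \<open>simp add: stiefel_def\<close>)
  then show ?thesis by eventually_elim (simp add: stiefel_nbhd_def)
qed

text \<open>The Hessian is Lipschitz near \<open>Xs\<close>, hence bounded there, and the mean value inequality along the
  segment from \<open>X\<close> to \<open>Xs\<close> turns this into the quadratic Taylor remainder of the gradient.\<close>
lemma critical_point_bounds_exist:
  fixes f :: "real^'p^'n \<Rightarrow> real"
  assumes lm: "local_minimizer_on f stiefel Xs" and "0 < \<epsilon>"
    and C2: "twice_continuously_differentiable_in f (stiefel_nbhd \<epsilon>)"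
    and lip: "L1-lipschitz_on (stiefel_nbhd \<epsilon>) (egrad f)"
    and "L2 > 0" and "\<delta>0 > 0"
    and hess_lip: "\<And>X Y. \<lbrakk>X \<in> ball Xs \<delta>0; Y \<in> ball Xs \<delta>0\<rbrakk> \<Longrightarrow>
           onorm (\<lambda>V. ehess f X V - ehess f Y V) \<le> L2 * norm (X - Y)"
  obtains M r where "critical_point_bounds f Xs M r" "ball Xs r \<subseteq> stiefel_nbhd \<epsilon>"
proof -
  have Xs: "Xs \<in> stiefel" using lm by (simp add: local_minimizer_on_def)
  then have gram: "transpose Xs ** Xs = mat 1" by (simp add: stiefel_def)
  obtain U where U: "open U" "stiefel_nbhd \<epsilon> \<subseteq> U"
    and f: "\<And>X. X \<in> U \<Longrightarrow> f differentiable (at X)"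
    and f': "\<And>X. X \<in> U \<Longrightarrow> egrad f differentiable (at X)"
    using C2 unfolding twice_continuously_differentiable_in_def by blast
  have inv: "invertible (transpose Xs ** Xs)" by (simp add: gram invertible_def)
  have "eventually (\<lambda>X. X \<in> stiefel_nbhd \<epsilon> \<and> invertible (transpose X ** X)) (nhds Xs)"
    using eventually_stiefel_nbhd[OF Xs \<open>0 < \<epsilon>\<close>] eventually_invertible_gram[OF inv]
    by (rule eventually_conj)
  then obtain r0 where r0: "0 < r0"
    "\<And>X. dist X Xs < r0 \<Longrightarrow> X \<in> stiefel_nbhd \<epsilon> \<and> invertible (transpose X ** X)"
    unfolding eventually_nhds_metric by blast
  define r where "r = min 1 (min r0 \<delta>0)"
  have r: "0 < r" "r \<le> 1" "r \<le> \<delta>0" using r0 \<open>\<delta>0 > 0\<close> by (simp_all add: r_def)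
  have B: "X \<in> stiefel_nbhd \<epsilon>" "invertible (transpose X ** X)" "X \<in> U" "X \<in> ball Xs \<delta>0" "norm (X - Xs) \<le> 1"
    if "X \<in> ball Xs r" for X
    using that r0(2)[of X] U(2) by (auto simp: r_def dist_commute dist_norm norm_minus_commute)
  have center: "Xs \<in> ball Xs r" using r by simp
  have ehess: "bounded_linear (ehess f X)" if "X \<in> ball Xs r" for X
    using has_derivative_ehess[OF f'[OF B(3)[OF that]]] by (rule has_derivative_bounded_linear)
  have L1: "0 \<le> L1" using lip by (rule lipschitz_on_nonneg)
  define H where "H = onorm (ehess f Xs)"
  have H: "0 \<le> H" "norm (ehess f Xs V) \<le> H * norm V" for V
    unfolding H_def using ehess[OF center] by (auto intro: onorm_pos_le onorm)
  define M where "M = 1 + norm Xs + norm (egrad f Xs) + L1 + H + L2"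
  have M: "1 \<le> M" "1 + norm Xs \<le> M" "norm (egrad f Xs) + L1 \<le> M" "L1 \<le> M" "H + L2 \<le> M" "L2 \<le> M"
    using L1 H(1) \<open>L2 > 0\<close> by (simp_all add: M_def)
  have grad_diff: "norm (egrad f X - egrad f Xs) \<le> L1 * norm (X - Xs)" if "X \<in> ball Xs r" for X
    using lipschitz_onD[OF lip B(1)[OF that] B(1)[OF center]] by (simp add: dist_norm)
  have hess_diff: "norm (ehess f X V - ehess f Xs V) \<le> L2 * norm (X - Xs) * norm V" if X: "X \<in> ball Xs r" for X V
  proof -
    have "norm (ehess f X V - ehess f Xs V) \<le> onorm (\<lambda>V. ehess f X V - ehess f Xs V) * norm V"
      by (rule onorm) (intro bounded_linear_sub ehess X center)
    also have "\<dots> \<le> L2 * norm (X - Xs) * norm V"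
      by (intro mult_right_mono hess_lip B X center norm_ge_zero)
    finally show ?thesis .
  qed
  have "critical_point_bounds f Xs M r"
  proof (rule critical_point_bounds.intro)
    show "skew (egrad f Xs ** transpose Xs) = 0"
      by (rule stiefel_critical[OF lm f[OF B(3)[OF center]]])
    show "norm (egrad f Xs) \<le> M" using M L1 by linarith
  next
    fix X assume X: "X \<in> ball Xs r"
    note d = B(5)[OF X]
    show "rgrad f X = 2 *\<^sub>R skew (egrad f X ** transpose X) ** X"
      by (rule rgrad_eq[OF B(2)[OF X] f[OF B(3)[OF X]]])
    show "linear (ehess f X)" using ehess[OF X] by (rule bounded_linear.linear)
    show "norm X \<le> M" using norm_triangle_sub[of X Xs] d M by linarith
    have "L1 * norm (X - Xs) \<le> L1" using d L1 by (rule mult_left_le)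
    then show "norm (egrad f X) \<le> M"
      using norm_triangle_sub[of "egrad f X" "egrad f Xs"] grad_diff[OF X] M by linarith
    show "norm (egrad f X - egrad f Xs) \<le> M * norm (X - Xs)"
      using grad_diff[OF X] mult_right_mono[OF M(4) norm_ge_zero[of "X - Xs"]] by linarith
    show "norm (egrad f Xs - egrad f X + ehess f X (X - Xs)) \<le> M * (norm (X - Xs))\<^sup>2"
    proof -
      have segment: "Y \<in> ball Xs r" "norm (Y - X) \<le> norm (X - Xs)" if "Y \<in> closed_segment X Xs" for Y
        using that closed_segment_subset[OF X center convex_ball] segment_bound1[OF that]
        by (auto simp: norm_minus_commute)
      have "norm (egrad f Xs - egrad f X - ehess f X (Xs - X)) \<le> norm (Xs - X) * (L2 * norm (X - Xs))"
      proof (rule differentiable_bound_linearization[where S = "closed_segment X Xs"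
            and f' = "ehess f" and ?x0.0 = X])
        show "X + t *\<^sub>R (Xs - X) \<in> closed_segment X Xs" if "t \<in> {0..1}" for t
          using that by (auto simp: in_segment algebra_simps)
        show "(egrad f has_derivative ehess f Y) (at Y within closed_segment X Xs)"
          if "Y \<in> closed_segment X Xs" for Y
          by (rule has_derivative_at_withinI[OF has_derivative_ehess[OF f'[OF B(3)[OF segment(1)[OF that]]]]])
        show "onorm (ehess f Y - ehess f X) \<le> L2 * norm (X - Xs)"
          if Y: "Y \<in> closed_segment X Xs" for Y
        proof -
          have "onorm (ehess f Y - ehess f X) \<le> L2 * norm (Y - X)"
            using hess_lip[OF B(4)[OF segment(1)[OF Y]] B(4)[OF X]] by (simp add: fun_diff_def)
          also have "\<dots> \<le> L2 * norm (X - Xs)"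
            using segment(2)[OF Y] \<open>L2 > 0\<close> by simp
          finally show ?thesis .
        qed
      qed simp
      also have "\<dots> = L2 * (norm (X - Xs))\<^sup>2"
        by (simp add: power2_eq_square norm_minus_commute)
      also have "\<dots> \<le> M * (norm (X - Xs))\<^sup>2"
        using M by (intro mult_right_mono) auto
      finally show ?thesis
        using linear_diff[OF bounded_linear.linear[OF ehess[OF X]], of 0 "X - Xs"]
          linear_0[OF bounded_linear.linear[OF ehess[OF X]]] by simp
    qed
    show "norm (ehess f X V) \<le> M * norm V" for V
    proof -
      have "norm (ehess f X V) \<le> H * norm V + L2 * norm (X - Xs) * norm V"
        using norm_triangle_sub[of "ehess f X V" "ehess f Xs V"] H(2)[of V] hess_diff[OF X, of V] by linarith
      also have "L2 * norm (X - Xs) * norm V \<le> L2 * norm V"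
        using d \<open>L2 > 0\<close> by (intro mult_right_mono mult_left_le) auto
      also have "H * norm V + L2 * norm V \<le> M * norm V"
        using mult_right_mono[OF M(5) norm_ge_zero[of V]] by (simp add: algebra_simps)
      finally show ?thesis by simp
    qed
    show "norm (ehess f X V - ehess f Xs V) \<le> M * norm (X - Xs) * norm V" for V
    proof -
      have "L2 * (norm (X - Xs) * norm V) \<le> M * (norm (X - Xs) * norm V)"
        using M by (intro mult_right_mono) auto
      then show ?thesis using hess_diff[OF X, of V] by (simp add: mult.assoc)
    qed
  qed (fact gram M(1) r)+
  moreover have "ball Xs r \<subseteq> stiefel_nbhd \<epsilon>" using B(1) by blast
  ultimately show ?thesis by (rule that)
qed

text \<open>This is the form in which nondegeneracy of the minimizer enters.\<close>
lemma layer_op_injective: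
  fixes f :: "real^'p^'n \<Rightarrow> real"
  assumes lm: "local_minimizer_on f stiefel Xs"
    and f: "eventually (\<lambda>Z. f differentiable (at Z)) (nhds Xs)"
    and f': "egrad f differentiable (at Xs)"
    and pos: "rhess_pos_def f Xs"
    and \<xi>: "\<xi> \<in> layer_tangent Xs" "layer_op f Xs \<xi> = 0"
  shows "\<xi> = 0"
proof (rule ccontr)
  have inv: "invertible (transpose Xs ** Xs)"
    using lm by (simp add: local_minimizer_on_def stiefel_def invertible_def)
  assume "\<xi> \<noteq> 0"
  with pos \<xi>(1) have "gmetric Xs (rhess f Xs \<xi>) \<xi> > 0" by (simp add: rhess_pos_def_def)
  moreover have "rhess f Xs \<xi> = 0"
    using rhess_eq_layer_op_at_critical_point[OF inv f f' stiefel_critical[OF lm eventually_nhds_x_imp_x[OF f]]] \<xi>(2)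
    by simp
  ultimately show False by simp
qed

theorem corollary5p12:
  fixes f :: "real^'p^'n \<Rightarrow> real"
    and Xs :: "real^'p^'n"
    and \<epsilon> L0 L1 L2 \<delta>0 \<zeta>max \<theta> :: real
  assumes "CARD('p) \<le> CARD('n)"
    and "0 < \<epsilon>" and "\<epsilon> < 1"
    and "local_minimizer_on f stiefel Xs"
    and "twice_continuously_differentiable_in f (stiefel_nbhd \<epsilon>)"
    and "L0-lipschitz_on (stiefel_nbhd \<epsilon>) f"
    and "L1-lipschitz_on (stiefel_nbhd \<epsilon>) (egrad f)"
    and "L2 > 0" and "\<delta>0 > 0"
    and "\<And>X Y. \<lbrakk>X \<in> ball Xs \<delta>0; Y \<in> ball Xs \<delta>0\<rbrakk> \<Longrightarrow>
           onorm (\<lambda>V. ehess f X V - ehess f Y V) \<le> L2 * norm (X - Y)"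
    and "rhess_pos_def f Xs"
    and "0 < \<zeta>max" and "\<zeta>max < 1"
    and "\<theta> > 0"
  shows "\<exists>\<delta>>0. \<forall>X T. X 0 \<in> ball Xs \<delta> \<inter> stiefel_nbhd \<epsilon> \<longrightarrow>
           inexact_newton_sequence f \<zeta>max \<theta> X T \<longrightarrow>
           (\<forall>k. X k \<in> stiefel_nbhd \<epsilon>) \<and>
           converges_with_order (min 2 (1 + \<theta>)) X Xs"
proof -
  obtain M r where bounds: "critical_point_bounds f Xs M r" and nbhd: "ball Xs r \<subseteq> stiefel_nbhd \<epsilon>"
    using critical_point_bounds_exist[OF assms(4,2,5,7-10)] by blast
  interpret critical_point_bounds f Xs M r by (rule bounds)
  obtain U where U: "open U" "Xs \<in> U" "\<And>X. X \<in> U \<Longrightarrow> f differentiable (at X)"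
    "egrad f differentiable (at Xs)"
    using assms(5) nbhd center unfolding twice_continuously_differentiable_in_def by blast
  have f: "eventually (\<lambda>Z. f differentiable (at Z)) (nhds Xs)"
    using eventually_nhds_in_open[OF U(1,2)] by eventually_elim (rule U(3))
  obtain C \<rho> where C: "0 \<le> C" and \<rho>: "0 < \<rho>" "\<rho> \<le> r"
    and step: "\<And>X T. X \<in> ball Xs \<rho> \<Longrightarrow> T \<in> layer_tangent X \<Longrightarrow>
       norm (newton_residual f X T) \<le> norm (newton_rhs f X) powr \<theta> * norm (newton_rhs f X) \<Longrightarrow>
       norm (X + (T + normal_step X) - Xs) \<le> C * norm (X - Xs) powr (min 2 (1 + \<theta>))"
    using inexact_newton_step[OF layer_op_injective[OF assms(4) f U(4) assms(11)] assms(14)] by blast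
  have q: "min 2 (1 + \<theta>) > 1" using assms(14) by simp
  obtain \<delta> where \<delta>: "0 < \<delta>"
    and conv: "\<And>x. x 0 \<in> ball Xs \<delta> \<Longrightarrow>
       (\<And>k. x k \<in> ball Xs \<rho> \<Longrightarrow> norm (x (Suc k) - Xs) \<le> C * norm (x k - Xs) powr (min 2 (1 + \<theta>))) \<Longrightarrow>
       (\<forall>k. x k \<in> ball Xs \<rho>) \<and> converges_with_order (min 2 (1 + \<theta>)) x Xs"
    using superlinear_convergence[OF q C \<rho>(1)] by blast
  show ?thesis
  proof (intro exI[of _ \<delta>] conjI[OF \<delta>] allI impI)
    fix X T
    assume X0: "X 0 \<in> ball Xs \<delta> \<inter> stiefel_nbhd \<epsilon>" and seq: "inexact_newton_sequence f \<zeta>max \<theta> X T"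
    have newton_step: "norm (X (Suc k) - Xs) \<le> C * norm (X k - Xs) powr (min 2 (1 + \<theta>))"
      if "X k \<in> ball Xs \<rho>" for k
    proof -
      let ?b = "norm (newton_rhs f (X k))"
      have T: "T k \<in> layer_tangent (X k)" and X: "X (Suc k) = X k + (T k + normal_step (X k))"
        and res: "norm (newton_residual f (X k) (T k)) \<le> min \<zeta>max (?b powr \<theta>) * ?b"
        using seq by (auto simp: inexact_newton_sequence_def)
      have "min \<zeta>max (?b powr \<theta>) * ?b \<le> ?b powr \<theta> * ?b"
        by (intro mult_right_mono) auto
      with res show ?thesis unfolding X by (intro step that T) linarith
    qed
    have "(\<forall>k. X k \<in> ball Xs \<rho>) \<and> converges_with_order (min 2 (1 + \<theta>)) X Xs"
      using X0 newton_step by (intro conv) auto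
    moreover have "ball Xs \<rho> \<subseteq> stiefel_nbhd \<epsilon>" using nbhd \<rho> by force
    ultimately show "(\<forall>k. X k \<in> stiefel_nbhd \<epsilon>) \<and> converges_with_order (min 2 (1 + \<theta>)) X Xs"
      by blast
  qed
qed

end
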